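(* Let $K$ be a field of characteristic zero, let $C\subseteq\mathbb R^d$ be a full-dimensional pointed rational polyhedral cone, and let $R=K[\mathbb Z^d\cap C]\subseteq K[x_1^{\pm1},\dots,x_d^{\pm1}]$ be its semigroup ring (the $K$-span of the monomials with exponent in $\mathbb Z^d\cap C$). Let $F_1,\dots,F_r$ be the facets of $C$, and for each $i$ let $\ell_i$ be the unique linear form on $\mathbb R^d$ with integral coprime coefficients such that $F_i\subseteq\ker\ell_i$ and $\ell_i$ is positive on the interior of $C$. Then $$\mathrm{s}^{\mathrm{diff}}_K(R)=d!\cdot\operatorname{vol}\{P\in C : (\ell_1+\cdots+\ell_r)(P)\le 1\}.$$
   Context: Pointed rational cone: a convex cone spanned by finitely many rays, each containing a nonzero point of $\mathbb Z^d$, and containing no lines. $\operatorname{vol}$ is Lebesgue measure on $\mathbb R^d$. $R$ is $\mathbb N$-graded by giving the monomial $x^\mu$ the degree $(\ell_1+\cdots+\ell_r)(\mu)$; its homogeneous maximal ideal $\mathfrak m$ is spanned by the monomials different from $1$, and $\dim R=d$. Differential operators: $D^0_{R|K}=\operatorname{Hom}_R(R,R)$ and $D^n_{R|K}=\{\delta\in\operatorname{Hom}_K(R,R) : [\delta,f]\in D^{n-1}_{R|K}\ \forall f\in R\}$. Differential powers: $\mathfrak m^{\langle n\rangle_K}=\{f\in R : \delta(f)\in\mathfrak m \text{ for all }\delta\in D^{n-1}_{R|K}\}$. Differential signature: $\mathrm{s}^{\mathrm{diff}}_K(R)=\limsup_{n\to\infty}\dfrac{\lambda_R(R/\mathfrak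 m^{\langle n\rangle_K})}{n^d/d!}$, where $\lambda_R$ is length. *)

theory Defs
  imports
    "HOL-Analysis.Analysis"
    "HOL-Algebra.Module"
    "HOL-Algebra.QuotRing"
    "HOL-Algebra.Algebraic_Closure_Type"
    "HOL-Library.Poly_Mapping"
begin

section \<open>Length of a module\<close>

text \<open>The length is \<open>\<infinity>\<close> if there are arbitrarily long chains of submodules.\<close>

definition module_length ::
    "('r, 'b) ring_scheme \<Rightarrow> ('r, 'a, 'c) module_scheme \<Rightarrow> enat" where
  "module_length R M = Sup {enat k | k. \<exists>N :: nat \<Rightarrow> 'a set.
     (\<forall>i\<le>k. submodule (N i) R M) \<and> (\<forall>i<k. N i \<subset> N (Suc i))}"

definition regular_module :: "('a, 'b) ring_scheme \<Rightarrow> ('a, 'a) module" where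
  "regular_module R =
     \<lparr>carrier = carrier R, monoid.mult = mult R, one = one R,
      zero = zero R, add = add R, smult = mult R\<rparr>"

definition quotient_module ::
    "('a, 'b) ring_scheme \<Rightarrow> 'a set \<Rightarrow> ('a, 'a set) module" where
  "quotient_module R I =
     \<lparr>carrier = carrier (R Quot I), monoid.mult = mult (R Quot I), one = one (R Quot I),
      zero = zero (R Quot I), add = add (R Quot I),
      smult = (\<lambda>r A. (I +>\<^bsub>R\<^esub> r) \<otimes>\<^bsub>R Quot I\<^esub> A)\<rparr>"


section \<open>Differential operators, powers and signature\<close>

text \<open>
  Maps between carriers are total functions on the ambient type whose values outside the
  carrier are arbitrary; membership in the sets below depends only on the values on the carrier.
\<close>

definition module_endomorphisms ::
    "('r, 'b) ring_scheme \<Rightarrow> ('r, 'a, 'c) module_scheme \<Rightarrow> ('a \<Rightarrow> 'a) set" where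
  "module_endomorphisms S M =
     {\<delta> \<in> carrier M \<rightarrow> carrier M.
        (\<forall>x\<in>carrier M. \<forall>y\<in>carrier M. \<delta> (x \<oplus>\<^bsub>M\<^esub> y) = \<delta> x \<oplus>\<^bsub>M\<^esub> \<delta> y) \<and>
        (\<forall>s\<in>carrier S. \<forall>x\<in>carrier M. \<delta> (s \<odot>\<^bsub>M\<^esub> x) = s \<odot>\<^bsub>M\<^esub> \<delta> x)}"

primrec diff_ops ::
    "('k, 'b) ring_scheme \<Rightarrow> ('k, 'a, 'c) module_scheme \<Rightarrow> nat \<Rightarrow> ('a \<Rightarrow> 'a) set" where
  "diff_ops K R 0 = module_endomorphisms R (regular_module R)"
| "diff_ops K R (Suc n) =
     {\<delta> \<in> module_endomorphisms K R.
        \<forall>f\<in>carrier R. (\<lambda>g. \<delta> (f \<otimes>\<^bsub>R\<^esub> g) \<ominus>\<^bsub>R\<^esub> f \<otimes>\<^bsub>R\<^esub> \<delta> g) \<in> diff_ops K R n}"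

text \<open>
  Meant for \<open>n \<ge> 1\<close>; the value at \<open>n = 0\<close> is irrelevant for the limit superior below.
\<close>

definition diff_power ::
    "('k, 'b) ring_scheme \<Rightarrow> ('k, 'a, 'c) module_scheme \<Rightarrow> 'a set \<Rightarrow> nat \<Rightarrow> 'a set" where
  "diff_power K R \<mm> n = {f \<in> carrier R. \<forall>\<delta>\<in>diff_ops K R (n - 1). \<delta> f \<in> \<mm>}"

text \<open>The parameter \<open>d\<close> is the dimension of \<open>R\<close>.\<close>

definition diff_signature ::
    "('k, 'b) ring_scheme \<Rightarrow> ('k, 'a, 'c) module_scheme \<Rightarrow> 'a set \<Rightarrow> nat \<Rightarrow> ennreal" where
  "diff_signature K R \<mm> d =
     limsup (\<lambda>n. ennreal_of_enat (module_length R (quotient_module R (diff_power K R \<mm> n)))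
                  / ennreal (real n ^ d / fact d))"


section \<open>Rational cones and their facets\<close>

definition real_vec :: "int ^ 'n \<Rightarrow> real ^ 'n" where
  "real_vec z = (\<chi> i. real_of_int (z $ i))"

text \<open>
  A ray containing a nonzero lattice point is spanned by that point, so the spanning rays are
  given by nonzero lattice points.
\<close>

definition pointed_rational_cone :: "(real ^ 'n) set \<Rightarrow> bool" where
  "pointed_rational_cone C \<longleftrightarrow>
     (\<exists>V :: (int ^ 'n) set. finite V \<and> 0 \<notin> V \<and> C = convex_cone hull (real_vec ` V)) \<and>
     (\<forall>a v. v \<noteq> 0 \<longrightarrow> \<not> {a + t *\<^sub>R v | t. True} \<subseteq> C)"

definition facet_form :: "(real ^ 'n) set \<Rightarrow> (real ^ 'n) set \<Rightarrow> real ^ 'n \<Rightarrow> real" where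
  "facet_form C F = (THE \<l>.
     (\<exists>a :: int ^ 'n. Gcd (range (\<lambda>i. a $ i)) = 1 \<and>
        \<l> = (\<lambda>P. \<Sum>i\<in>UNIV. real_of_int (a $ i) * P $ i)) \<and>
     (\<forall>P\<in>F. \<l> P = 0) \<and>
     (\<forall>P\<in>interior C. \<l> P > 0))"


section \<open>Semigroup rings\<close>

text \<open>
  The Laurent polynomial ring over \<open>'k\<close> is the type \<open>(int ^ 'n) \<Rightarrow>\<^sub>0 'k\<close> of finitely
  supported functions on exponent vectors, with the convolution product; \<open>single \<mu> 1\<close> is the
  monomial with exponent \<open>\<mu>\<close>.
\<close>

definition lattice_points :: "(real ^ 'n) set \<Rightarrow> (int ^ 'n) set" where
  "lattice_points C = {\<mu>. real_vec \<mu> \<in> C}"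

definition monomial_span :: "(int ^ 'n) set \<Rightarrow> ((int ^ 'n) \<Rightarrow>\<^sub>0 'k::comm_ring_1) set" where
  "monomial_span S = {f. Poly_Mapping.keys f \<subseteq> S}"

definition semigroup_ring ::
    "(real ^ 'n) set \<Rightarrow> ('k::comm_ring_1, (int ^ 'n) \<Rightarrow>\<^sub>0 'k) module" where
  "semigroup_ring C =
     \<lparr>carrier = monomial_span (lattice_points C), monoid.mult = (*), one = 1,
      zero = 0, add = (+), smult = (\<lambda>c f. Poly_Mapping.single 0 c * f)\<rparr>"

definition homogeneous_max_ideal ::
    "(real ^ 'n) set \<Rightarrow> ((int ^ 'n) \<Rightarrow>\<^sub>0 'k::comm_ring_1) set" where
  "homogeneous_max_ideal C = monomial_span (lattice_points C - {0})"

end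

theory Submission
  imports Defs
begin

text \<open>
  Write \<open>\<ell> = \<ell>\<^sub>1 + \<dots> + \<ell>\<^sub>r\<close>. For an exponent \<open>\<mu>\<close> the operator \<open>x\<^sup>\<nu> \<mapsto> p(\<nu>) x\<^bsup>\<nu> - \<mu>\<^esup>\<close>, where \<open>p\<close>
  is the product of the factors \<open>\<ell>\<^sub>i - j\<close> with \<open>0 \<le> j < \<ell>\<^sub>i(\<mu>)\<close>, preserves the semigroup ring, has
  order \<open>\<ell>(\<mu>)\<close>, and maps \<open>x\<^sup>\<mu>\<close> to a nonzero constant. Conversely, if \<open>\<delta>\<close> has order at most \<open>n\<close>, then the
  coefficient of \<open>x\<^bsup>\<nu> - \<mu>\<^esup>\<close> in \<open>\<delta>(x\<^sup>\<nu>)\<close> is a polynomial function of \<open>\<nu>\<close> of degree at most \<open>n\<close>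
  that vanishes whenever \<open>\<nu> - \<mu> \<notin> C\<close>, hence on the \<open>\<ell>(\<mu>)\<close> distinct hyperplanes \<open>\<ell>\<^sub>i = j\<close>, so that it is
  zero if \<open>\<ell>(\<mu>) > n\<close>. Therefore the \<open>n\<close>-th differential power is spanned by the monomials with
  \<open>\<ell> \<ge> n\<close>, the length of its quotient is the number of lattice points of \<open>C\<close> with \<open>\<ell> < n\<close>, and
  this number divided by \<open>n\<^sup>d\<close> tends to the volume of the part of \<open>C\<close> where \<open>\<ell> < 1\<close>.
\<close>

section \<open>Functions of bounded difference degree\<close>

text \<open>Three obstacles shape the argument for the lower bound on \<open>\<ell>\<close>. A
  coefficient function of an operator exists only on the lattice points of the cone, where only
  differences in directions of the cone make sense, so it has to be extended to the whole lattice
  before hyperplanes can be divided out. Its vanishing is also known only inside the cone: a lattice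
  point with \<open>\<ell>\<^sub>i = j\<close> may have other forms negative, and it is carried into
  the cone along a lattice vector in the relative interior of the facet, using that a polynomial
  function which vanishes far out on a line vanishes on all of it. Finally, dividing by
  \<open>\<ell>\<^sub>i - j\<close> requires a lattice direction in which
  \<open>\<ell>\<^sub>i\<close> grows by exactly one, which coprime coefficients provide, and
  binomial coefficients, which require characteristic zero.\<close>

text \<open>
  Polynomial functions of degree less than \<open>n\<close> on an abelian group, without choosing coordinates:
  all \<open>n\<close>-fold differences vanish (so \<open>n = 0\<close> means the zero function). On a submonoid \<open>S\<close> only
  differences in directions from \<open>S\<close> make sense.
\<close>

fun diff_deg_less_on ::
    "'a::ab_group_add set \<Rightarrow> nat \<Rightarrow> ('a \<Rightarrow> 'k::ab_group_add) \<Rightarrow> bool" where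
  "diff_deg_less_on S 0 f \<longleftrightarrow> (\<forall>x\<in>S. f x = 0)"
| "diff_deg_less_on S (Suc n) f \<longleftrightarrow> (\<forall>b\<in>S. diff_deg_less_on S n (\<lambda>x. f (x + b) - f x))"

abbreviation diff_deg_less :: "nat \<Rightarrow> ('a::ab_group_add \<Rightarrow> 'k::ab_group_add) \<Rightarrow> bool" where
  "diff_deg_less \<equiv> diff_deg_less_on UNIV"

lemma diff_deg_less_zero: "diff_deg_less n (\<lambda>x. 0)"
  by (induction n) auto

lemma diff_deg_less_Suc: "diff_deg_less n f \<Longrightarrow> diff_deg_less (Suc n) f"
proof (induction n arbitrary: f)
  case (Suc n)
  then show ?case by (metis diff_deg_less_on.simps(2))
qed simp

lemma diff_deg_less_mono: "m \<le> n \<Longrightarrow> diff_deg_less m f \<Longrightarrow> diff_deg_less n f"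
  by (induction n rule: dec_induct) (auto simp del: diff_deg_less_on.simps intro: diff_deg_less_Suc)

lemma diff_deg_less_add:
  "diff_deg_less n f \<Longrightarrow> diff_deg_less n g \<Longrightarrow> diff_deg_less n (\<lambda>x. f x + g x)"
proof (induction n arbitrary: f g)
  case (Suc n)
  have "diff_deg_less n (\<lambda>x. (f (x + b) - f x) + (g (x + b) - g x))" for b
    using Suc by simp
  then show ?case by (simp add: algebra_simps)
qed simp

lemma diff_deg_less_uminus: "diff_deg_less n f \<Longrightarrow> diff_deg_less n (\<lambda>x. - f x)"
proof (induction n arbitrary: f)
  case (Suc n)
  then have "diff_deg_less n (\<lambda>x. - (f (x + b) - f x))" for b
    by (simp del: minus_diff_eq)
  then show ?case by (simp add: algebra_simps)
qed simp

lemma diff_deg_less_diff: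
  "diff_deg_less n f \<Longrightarrow> diff_deg_less n g \<Longrightarrow> diff_deg_less n (\<lambda>x. f x - g x)"
  using diff_deg_less_add[OF _ diff_deg_less_uminus] by fastforce

lemma diff_deg_less_sum:
  "(\<And>i. i \<in> A \<Longrightarrow> diff_deg_less n (f i)) \<Longrightarrow> diff_deg_less n (\<lambda>x. \<Sum>i\<in>A. f i x)"
  by (induction A rule: infinite_finite_induct)
     (auto intro: diff_deg_less_zero diff_deg_less_add)

lemma diff_deg_less_cmult:
  fixes c :: "'k::ring"
  shows "diff_deg_less n f \<Longrightarrow> diff_deg_less n (\<lambda>x. c * f x)"
proof (induction n arbitrary: f)
  case (Suc n)
  then have "diff_deg_less n (\<lambda>x. c * (f (x + b) - f x))" for b by simp
  then show ?case by (simp add: algebra_simps)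
qed simp

lemma diff_deg_less_compose:
  assumes "Modules.additive \<pi>"
  shows "diff_deg_less n f \<Longrightarrow> diff_deg_less n (\<lambda>x. f (\<pi> x + c))"
proof (induction n arbitrary: f)
  case (Suc n)
  have "diff_deg_less n (\<lambda>x. f (\<pi> x + c + \<pi> b) - f (\<pi> x + c))" for b
    using Suc.IH[of "\<lambda>x. f (x + \<pi> b) - f x"] Suc.prems by simp
  then show ?case by (simp add: Modules.additive.add[OF assms] add_ac)
qed simp

lemma diff_deg_less_shift: "diff_deg_less n f \<Longrightarrow> diff_deg_less n (\<lambda>x. f (x + c))"
  by (rule diff_deg_less_compose[of "\<lambda>x. x"]) (auto simp: Modules.additive_def)

text \<open>Discrete product rule: the difference along \<open>b\<close> is \<open>a x + c\<close>
  times the difference of \<open>f\<close>, plus \<open>a b * f (x + b)\<close>. Induction handles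
  the first summand; the second is a multiple of a shift of \<open>f\<close>.\<close>

lemma diff_deg_less_mult_affine:
  fixes c :: "'k::comm_ring"
  assumes "Modules.additive a"
  shows "diff_deg_less n f \<Longrightarrow> diff_deg_less (Suc n) (\<lambda>x. (a x + c) * f x)"
proof (induction n arbitrary: f)
  case (Suc n)
  have "diff_deg_less (Suc n) (\<lambda>x. (a x + c) * (f (x + b) - f x) + a b * f (x + b))" for b
    using Suc by (intro diff_deg_less_add diff_deg_less_cmult diff_deg_less_shift) auto
  then show ?case
    by (subst diff_deg_less_on.simps) (simp add: Modules.additive.add[OF assms] algebra_simps del: diff_deg_less_on.simps)
qed simp


text \<open>By induction the unit difference vanishes along the line, so \<open>f\<close> is
  constant there, hence zero. Only one end of the line is needed, which is how values deep inside a
  cone determine a value anywhere.\<close>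

lemma diff_deg_less_ray_eq_0:
  fixes \<iota> :: "int \<Rightarrow> 'a::ab_group_add"
  assumes "Modules.additive \<iota>"
  assumes "diff_deg_less n f" and "\<And>t. t \<ge> T \<Longrightarrow> f (x + \<iota> t) = 0"
  shows "f x = 0"
  using assms(2,3)
proof (induction n arbitrary: f x T)
  case (Suc n)
  interpret Modules.additive \<iota> by fact
  have const: "f (x + \<iota> s) = f (x + \<iota> s + \<iota> 1)" for s
  proof -
    have "f (x + \<iota> s + \<iota> 1) - f (x + \<iota> s) = 0"
    \<comment> \<open>The base point moves to \<open>x + \<iota> s\<close>, so the threshold drops
      by \<open>s\<close>.\<close>
    proof (rule Suc.IH[of "\<lambda>y. f (y + \<iota> 1) - f y" "T - s" "x + \<iota> s"])
      fix t assume "t \<ge> T - s"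
      then have "f (x + \<iota> (s + t)) = 0" "f (x + \<iota> (s + t + 1)) = 0"
        using Suc.prems(2) by auto
      then show "f (x + \<iota> s + \<iota> t + \<iota> 1) - f (x + \<iota> s + \<iota> t) = 0"
        by (simp add: add add_ac)
    qed (use Suc.prems in auto)
    then show ?thesis by simp
  qed
  have "f (x + \<iota> (int s)) = f x" for s
    using const[of "int s" for s] by (induction s) (auto simp: add zero add_ac)
  from this[of "nat T"] show ?case using Suc.prems(2)[of "int (nat T)"] by simp
qed simp

section \<open>Newton expansion and division by an affine form\<close>

definition forward_diff :: "'a::ab_group_add \<Rightarrow> ('a \<Rightarrow> 'k::ab_group_add) \<Rightarrow> 'a \<Rightarrow> 'k" where
  "forward_diff b f x = f (x + b) - f x"

lemma diff_deg_less_forward_diff: 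
  "diff_deg_less (Suc n) f \<Longrightarrow> diff_deg_less n (forward_diff b f)"
  by (simp add: forward_diff_def[abs_def])

text \<open>Truncated subtraction is harmless: once \<open>n - s\<close> is \<open>0\<close>, the
  iterated difference is the zero function and stays so.\<close>

lemma diff_deg_less_forward_diff_iterate:
  "diff_deg_less n f \<Longrightarrow> diff_deg_less (n - s) ((forward_diff b ^^ s) f)"
proof (induction s)
  case (Suc s)
  then have *: "diff_deg_less (n - s) ((forward_diff b ^^ s) f)" by simp
  show ?case
  proof (cases "n - s")
    case 0
    then show ?thesis using * by (simp add: forward_diff_def[of b "(forward_diff b ^^ s) f"])
  next
    case (Suc m)
    then have "n - Suc s = m" by simp
    with * show ?thesis using diff_deg_less_forward_diff[of m _ b] by (simp add: Suc)
  qed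
qed simp

text \<open>Both sides agree at \<open>t = 0\<close> and, by Pascal's rule and induction, have the
  same unit differences in \<open>t\<close>. As \<open>t\<close> may be negative, the inner
  induction runs both ways and the coefficients are generalized binomials.\<close>

lemma newton_expansion:
  fixes f :: "'a::ab_group_add \<Rightarrow> 'k::field_char_0"
  assumes "Modules.additive \<iota>"
  shows "diff_deg_less n f \<Longrightarrow>
    f (x + \<iota> t) = (\<Sum>s<n. (of_int t gchoose s) * (forward_diff (\<iota> 1) ^^ s) f x)"
proof (induction n arbitrary: f t)
  case (Suc n)
  interpret Modules.additive \<iota> by fact
  define g where "g t = (\<Sum>s<Suc n. (of_int t gchoose s) * (forward_diff (\<iota> 1) ^^ s) f x)" for t :: int
  have g_step: "g (t + 1) - g t = f (x + \<iota> (t + 1)) - f (x + \<iota> t)" for t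
  proof -
    have "g (t + 1) - g t = (\<Sum>s<n. ((of_int t + 1 gchoose Suc s) - (of_int t gchoose Suc s)) * 
        (forward_diff (\<iota> 1) ^^ Suc s) f x)"
      unfolding g_def sum_subtractf[symmetric] sum.lessThan_Suc_shift
      by (simp add: algebra_simps sum_subtractf del: funpow.simps)
    also have "\<dots> = (\<Sum>s<n. (of_int t gchoose s) * (forward_diff (\<iota> 1) ^^ s) (forward_diff (\<iota> 1) f) x)"
      by (simp only: gbinomial_Suc_Suc) (simp add: funpow_swap1)
    also have "\<dots> = forward_diff (\<iota> 1) f (x + \<iota> t)"
      by (rule Suc.IH[symmetric]) (use Suc.prems diff_deg_less_forward_diff in blast)
    finally show ?thesis by (simp add: forward_diff_def add add_ac)
  qed
  have "g t = f (x + \<iota> t)"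
  proof (induction t rule: int_induct[of _ 0])
    case base
    have "g 0 = f x + (\<Sum>s<n. ((0::'k) gchoose Suc s) * (forward_diff (\<iota> 1) ^^ Suc s) f x)"
      unfolding g_def sum.lessThan_Suc_shift by (simp del: funpow.simps)
    then show ?case by (simp add: zero)
  next
    case (step1 i) then show ?case using g_step[of i] by simp
  next
    case (step2 i) then show ?case using g_step[of "i - 1"] by simp
  qed
  then show ?case by (simp add: g_def)
qed simp

text \<open>Up to a scalar, the binomial coefficient is a product of \<open>s\<close> affine
  functions, each of which raises the degree by at most one.\<close>

lemma diff_deg_less_mult_gbinomial:
  fixes a :: "'a::ab_group_add \<Rightarrow> 'k::field_char_0"
  assumes "Modules.additive a" "diff_deg_less n f"
  shows "diff_deg_less (n + s) (\<lambda>x. (a x + c gchoose s) * f x)"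
proof (induction s)
  case (Suc s)
  have "diff_deg_less (Suc (n + s)) (\<lambda>x. inverse (of_nat (Suc s)) * ((a x + (c - of_nat s)) * ((a x + c gchoose s) * f x)))"
    using Suc by (intro diff_deg_less_cmult diff_deg_less_mult_affine assms)
  also have "(\<lambda>x. inverse (of_nat (Suc s)) * ((a x + (c - of_nat s)) * ((a x + c gchoose s) * f x)))
     = (\<lambda>x. (a x + c gchoose Suc s) * f x)"
  proof
    fix x
    have "(a x + c gchoose Suc s) = (a x + c - of_nat s) * (a x + c gchoose s) * inverse (of_nat (Suc s))"
      using gbinomial_mult_1[of "a x + c" s] 
      by (simp add: field_simps del: of_nat_Suc)
    then show "inverse (of_nat (Suc s)) * ((a x + (c - of_nat s)) * ((a x + c gchoose s) * f x)) = (a x + c gchoose Suc s) * f x"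
      by (simp only: add_diff_eq mult_ac)
  qed
  finally show ?case by simp
qed (use assms in simp)

text \<open>The quotient \<open>q\<close> is read off from the Newton expansion in a direction transversal to the hyperplane.\<close>

lemma diff_deg_less_factor_hyperplane:
  fixes f :: "'a::ab_group_add \<Rightarrow> 'k::field_char_0" and a :: "'a \<Rightarrow> int"
    and \<iota> :: "int \<Rightarrow> 'a"
  assumes a: "Modules.additive a" and \<iota>: "Modules.additive \<iota>" "a (\<iota> 1) = 1"
    and f: "diff_deg_less (Suc n) f" and f0: "\<And>x. a x = j \<Longrightarrow> f x = 0"
  obtains q where "diff_deg_less n q" "\<And>x. f x = of_int (a x - j) * q x"
proof -
  interpret a: Modules.additive a by fact
  interpret \<iota>: Modules.additive \<iota> by fact
  have a\<iota>: "a (\<iota> t) = t" for t :: int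
    by (induction t rule: int_induct[of _ 0]) (auto simp: a.zero \<iota>.zero \<iota>.add a.add \<iota>.diff a.diff \<iota>(2))
  \<comment> \<open>The translation moves the hyperplane \<open>a x = j\<close> to the kernel of
    \<open>a\<close>.\<close>
  define g where "g x = f (x + \<iota> j)" for x
  have g: "diff_deg_less (Suc n) g"
    unfolding g_def[abs_def] by (rule diff_deg_less_shift[OF f])
  define \<pi> where "\<pi> x = x - \<iota> (a x)" for x
  have \<pi>: "Modules.additive \<pi>"
    by (auto simp: Modules.additive_def \<pi>_def a.add \<iota>.add)
  have g\<pi>: "g (\<pi> x) = 0" for x
    by (simp add: g_def \<pi>_def f0 a.add a.diff a\<iota>)
  \<comment> \<open>With \<open>t = a x\<close>, absorption writes \<open>t gchoose Suc s\<close> as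
    \<open>t / (s + 1)\<close> times \<open>(t - 1) gchoose s\<close>, hence the inverse and the
    \<open>-1\<close>. The term of index zero in the Newton expansion is
    \<open>g (\<pi> x) = 0\<close>.\<close>
  define q where "q x = (\<Sum>s<n. inverse (of_nat (Suc s)) * ((of_int (a x) + (-1) gchoose s) *
      (forward_diff (\<iota> 1) ^^ Suc s) g (\<pi> x + 0)))" for x
  have deg: "diff_deg_less n q" unfolding q_def[abs_def]
  proof (intro diff_deg_less_sum diff_deg_less_cmult)
    fix s assume "s \<in> {..<n}"
    \<comment> \<open>\<open>Suc s\<close> differences lower the bound from \<open>Suc n\<close> to
      \<open>n - s\<close>, and the binomial coefficient raises it by \<open>s\<close>
      again.\<close>
    then have s: "n = (Suc n - Suc s) + s" by auto
    show "diff_deg_less n (\<lambda>x. (of_int (a x) + (-1) gchoose s) * (forward_diff (\<iota> 1) ^^ Suc s) g (\<pi> x + 0))"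
      by (subst s, intro diff_deg_less_mult_gbinomial diff_deg_less_compose \<pi> diff_deg_less_forward_diff_iterate[OF g])
        (auto simp: Modules.additive_def a.add)
  qed
  have gq: "g x = of_int (a x) * q x" for x
  proof -
    have "g x = g (\<pi> x + \<iota> (a x))" by (simp add: \<pi>_def)
    also have "\<dots> = (\<Sum>s<Suc n. (of_int (a x) gchoose s) * (forward_diff (\<iota> 1) ^^ s) g (\<pi> x))"
      by (rule newton_expansion[OF \<iota>(1) g])
    also have "\<dots> = (\<Sum>s<n. (of_int (a x) gchoose Suc s) * (forward_diff (\<iota> 1) ^^ Suc s) g (\<pi> x))"
      by (subst sum.lessThan_Suc_shift) (simp add: g\<pi>)
    also have "\<dots> = of_int (a x) * q x"
      unfolding q_def sum_distrib_left
    proof (intro sum.cong refl)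
      fix s
      have "(of_int (a x) gchoose Suc s) = of_int (a x) * (inverse (of_nat (Suc s)) * (of_int (a x) + (-1) gchoose s :: 'k))"
        using gbinomial_absorption[of s "of_int (a x) :: 'k"] by (simp add: field_simps del: of_nat_Suc)
      then show "(of_int (a x) gchoose Suc s) * (forward_diff (\<iota> 1) ^^ Suc s) g (\<pi> x)
        = of_int (a x) * (inverse (of_nat (Suc s)) * ((of_int (a x) + (-1) gchoose s) *
      (forward_diff (\<iota> 1) ^^ Suc s) g (\<pi> x + 0)))"
        by (simp only: mult_ac add_0_right)
    qed
    finally show ?thesis .
  qed
  show ?thesis
  proof (rule that[of "\<lambda>x. q (x + - \<iota> j)"])
    show "f x = of_int (a x - j) * q (x + - \<iota> j)" for x
      using gq[of "x - \<iota> j"] by (simp add: g_def a.diff a\<iota>)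
  qed (rule diff_deg_less_shift[OF deg])
qed

text \<open>Each division by \<open>a - j\<close> lowers the degree bound by one, until nothing is
  left. The quotient is known to vanish on another hyperplane only off \<open>a = j\<close>; the
  last hypothesis provides a direction inside the other hyperplane that leaves
  \<open>a = j\<close>.\<close>

lemma diff_deg_less_hyperplanes_eq_0:
  fixes f :: "'a::ab_group_add \<Rightarrow> 'k::field_char_0" and H :: "(('a \<Rightarrow> int) \<times> int) set"
  assumes "finite H" "n \<le> card H" "diff_deg_less n f"
    and "\<And>a j x. (a, j) \<in> H \<Longrightarrow> a x = j \<Longrightarrow> f x = 0"
    and "\<And>a j. (a, j) \<in> H \<Longrightarrow> Modules.additive a \<and> (\<exists>\<iota> :: int \<Rightarrow> 'a. Modules.additive \<iota> \<and> a (\<iota> 1) = 1)"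
    and "\<And>a j a' j'. (a, j) \<in> H \<Longrightarrow> (a', j') \<in> H \<Longrightarrow> a \<noteq> a' \<Longrightarrow>
           \<exists>\<iota> :: int \<Rightarrow> 'a. Modules.additive \<iota> \<and> a' (\<iota> 1) = 0 \<and> a (\<iota> 1) \<noteq> 0"
  shows "f x = 0"
  using assms
proof (induction H arbitrary: n f x rule: finite_induct)
  case (insert h H)
  obtain a j where h: "h = (a, j)" by force
  show ?case
  proof (cases n)
    case (Suc m)
    obtain \<iota> :: "int \<Rightarrow> 'a"
      where \<iota>: "Modules.additive \<iota>" "a (\<iota> 1) = 1" and a: "Modules.additive a" using insert.prems(4) h by blast
    obtain q where q: "diff_deg_less m q" "\<And>x. f x = of_int (a x - j) * q x"
      using diff_deg_less_factor_hyperplane[OF a \<iota>, of m f j] insert.prems(2,3) h Suc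
      by (metis insertI1)
    have "q x = 0" for x
    proof (rule insert.IH[of m q])
      fix a' j' y assume H: "(a', j') \<in> H" and y: "a' y = j'"
      have q0: "q z = 0" if "a' z = j'" "a z \<noteq> j" for z
        using insert.prems(3)[of a' j' z] H q(2)[of z] that by auto
      show "q y = 0"
      proof (cases "a y = j")
        case True
        \<comment> \<open>Distinct level sets of the same form do not meet, so a common point forces
          distinct forms.\<close>
        then have "a' \<noteq> a" using H y h insert.hyps by auto
        then obtain \<kappa> :: "int \<Rightarrow> 'a" where \<kappa>: "Modules.additive \<kappa>" "a' (\<kappa> 1) = 0" "a (\<kappa> 1) \<noteq> 0"
          using insert.prems(5)[of a j a' j'] H h by auto
        interpret \<kappa>: Modules.additive \<kappa> by fact
        interpret a: Modules.additive a by fact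
        interpret a': Modules.additive a' using insert.prems(4) H by blast
        have k: "a' (\<kappa> t) = 0" "a (\<kappa> t) = t * a (\<kappa> 1)" for t
          by (induction t rule: int_induct[of _ 0])
             (auto simp: \<kappa> a.zero a'.zero \<kappa>.zero \<kappa>.add a.add a'.add \<kappa>.diff a.diff a'.diff algebra_simps)
        show ?thesis
        \<comment> \<open>From \<open>t = 1\<close> on, the line has left \<open>a = j\<close>,
          since \<open>a\<close> changes by \<open>t * a (\<kappa> 1)\<close>, while
          \<open>a'\<close> stays at \<open>j'\<close>.\<close>
        proof (rule diff_deg_less_ray_eq_0[OF \<kappa>(1) q(1), of 1])
          fix t :: int assume "t \<ge> 1"
          then show "q (y + \<kappa> t) = 0"
            using \<kappa>(3) y True by (intro q0) (auto simp: a.add a'.add k(1) k(2)[of t])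
        qed
      next
        case False
        then show ?thesis by (rule q0[OF y])
      qed
    next
      show "m \<le> card H" using insert.hyps insert.prems(1) Suc by simp
    next
      show "diff_deg_less m q" by (rule q)
    next
      fix a j assume "(a, j) \<in> H"
      then show "Modules.additive a \<and> (\<exists>\<iota> :: int \<Rightarrow> 'a. Modules.additive \<iota> \<and> a (\<iota> 1) = 1)"
        by (intro insert.prems(4)) auto
    next
      fix a j a' j' assume "(a, j) \<in> H" "(a', j') \<in> H" "a \<noteq> a'"
      then show "\<exists>\<iota> :: int \<Rightarrow> 'a. Modules.additive \<iota> \<and> a' (\<iota> 1) = 0 \<and> a (\<iota> 1) \<noteq> 0"
        by (intro insert.prems(5)) auto
    qed
    then show ?thesis by (simp add: q)
  qed (use insert.prems(2) in simp)
qed simp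

section \<open>Extension from a submonoid to the whole group\<close>

text \<open>By induction the differences of \<open>f\<close> along each \<open>b\<close> in
  \<open>S\<close> extend to functions \<open>F b\<close> on the group, and \<open>f\<close> is then
  integrated along them. Uniqueness turns identities that hold on \<open>S\<close> into identities
  everywhere, in particular the cocycle relation that makes the integration independent of the
  path.\<close>

lemma diff_deg_less_on_extend:
  fixes S :: "'a::ab_group_add set" and f :: "'a \<Rightarrow> 'k::ab_group_add"
  assumes S0: "0 \<in> S" and Sadd: "\<And>x y. x \<in> S \<Longrightarrow> y \<in> S \<Longrightarrow> x + y \<in> S"
    and ex: "\<And>x. \<exists>u\<in>S. x + u \<in> S"
    and uniq: "\<And>n (g :: 'a \<Rightarrow> 'k) x. diff_deg_less n g \<Longrightarrow> (\<And>s. s \<in> S \<Longrightarrow> g s = 0) \<Longrightarrow> g x = 0"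
  shows "diff_deg_less_on S n f \<Longrightarrow> \<exists>g. diff_deg_less n g \<and> (\<forall>x\<in>S. g x = f x)"
proof (induction n arbitrary: f)
  case 0
  then show ?case by (intro exI[of _ "\<lambda>x. 0"]) auto
next
  case (Suc n)
  then have "\<forall>b\<in>S. \<exists>g. diff_deg_less n g \<and> (\<forall>x\<in>S. g x = f (x + b) - f x)"
    by simp
  then obtain F where F: "\<And>b. b \<in> S \<Longrightarrow> diff_deg_less n (F b)"
    "\<And>b x. b \<in> S \<Longrightarrow> x \<in> S \<Longrightarrow> F b x = f (x + b) - f x"
    by metis
  have cocycle: "F (b + c) x = F b (x + c) + F c x" if bc: "b \<in> S" "c \<in> S" for b c x
  proof -
    have "F (b + c) x - (F b (x + c) + F c x) = 0"
    proof (rule uniq)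
      show "diff_deg_less n (\<lambda>x. F (b + c) x - (F b (x + c) + F c x))"
        using bc by (intro diff_deg_less_diff diff_deg_less_add diff_deg_less_shift F Sadd)
    qed (use bc in \<open>simp add: F Sadd algebra_simps\<close>)
    then show ?thesis by simp
  qed
  obtain u where u: "\<And>x. u x \<in> S" "\<And>x. x + u x \<in> S" using ex by metis
  \<comment> \<open>\<open>F b\<close> extends the difference of \<open>f\<close> along \<open>b\<close>; moving \<open>x\<close> into \<open>S\<close> along any \<open>u\<close> gives the same value\<close>
  define g where "g x = f (x + u x) - F (u x) x" for x
  have g: "g x = f (x + v) - F v x" if v: "v \<in> S" "x + v \<in> S" for x v
  proof -
    \<comment> \<open>Both candidate values are compared through
      \<open>f (x + u x + v)\<close>.\<close>
    have 1: "f (x + u x) = f (x + u x + v) - F v (x + u x)"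
      using F(2)[of v "x + u x"] v u[of x] by simp
    have 2: "f (x + v) = f (x + u x + v) - F (u x) (x + v)"
      using F(2)[of "u x" "x + v"] v u[of x] by (simp add: add_ac)
    have 3: "F (u x) x = F v x + F (u x) (x + v) - F v (x + u x)"
      using cocycle[of v "u x" x] cocycle[of "u x" v x] v u[of x] by (simp add: algebra_simps)
    show ?thesis unfolding g_def 1 2 3 by simp
  qed
  have Delta: "g (x + b) - g x = F b x" if b: "b \<in> S" for b x
  proof -
    have "x + u x + b \<in> S" using b u Sadd by blast
    then have "g (x + b) = f (x + u x + b) - F (u x) (x + b)"
      using g[of "u x" "x + b"] u by (simp add: add_ac)
    moreover have "g x = f (x + u x + b) - F b (x + u x) - F (u x) x"
      using F(2)[of b "x + u x"] b u[of x] by (simp add: g_def)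
    moreover have "F (u x) (x + b) = F b (x + u x) + F (u x) x - F b x"
      using cocycle[of "u x" b x] cocycle[of b "u x" x] b u[of x] by (simp add: algebra_simps)
    ultimately show ?thesis by simp
  qed
  have "diff_deg_less (Suc n) g"
    unfolding diff_deg_less_on.simps
  proof
    fix b :: 'a
    \<comment> \<open>An arbitrary direction \<open>b\<close> is the difference of the elements
      \<open>b + v\<close> and \<open>v\<close> of \<open>S\<close>.\<close>
    obtain v where v: "v \<in> S" "b + v \<in> S" using ex by blast
    have "g (x + b) - g x = F (b + v) (x + - v) - F v (x + - v)" for x
      using Delta[OF v(1), of "x - v"] Delta[OF v(2), of "x - v"] by (simp add: algebra_simps)
    moreover have "diff_deg_less n (\<lambda>x. F (b + v) (x + - v) - F v (x + - v))"
      by (intro diff_deg_less_diff diff_deg_less_shift F v)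
    ultimately show "diff_deg_less n (\<lambda>x. g (x + b) - g x)" by simp
  qed
  moreover have "g x = f x" if "x \<in> S" for x
    using g[of 0 x] that S0 F(2)[of 0 x] by simp
  ultimately show ?case by blast
qed

section \<open>Differential operators on semigroup rings\<close>

lemma lookup_single_times:
  fixes f :: "'a::ab_group_add \<Rightarrow>\<^sub>0 'k::comm_ring_1"
  shows "Poly_Mapping.lookup (Poly_Mapping.single b c * f) k = c * Poly_Mapping.lookup f (k - b)"
proof -
  have "Poly_Mapping.lookup (Poly_Mapping.single b c * f) k
     = Sum_any (\<lambda>l. c * Sum_any (\<lambda>q. Poly_Mapping.lookup f q when k = l + q) when b = l)"
    unfolding lookup_mult by (rule Sum_any.cong) (simp add: lookup_single when_mult)
  also have "\<dots> = c * Sum_any (\<lambda>q. Poly_Mapping.lookup f q when k = b + q)"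
    by simp
  also have "(\<lambda>q. Poly_Mapping.lookup f q when k = b + q) = (\<lambda>q. Poly_Mapping.lookup f q when q = k - b)"
    by (auto simp: fun_eq_iff when_def)
  finally show ?thesis by simp
qed

lemma poly_mapping_sum_single:
  "f = (\<Sum>b\<in>Poly_Mapping.keys f. Poly_Mapping.single b (Poly_Mapping.lookup f b))"
  by (rule poly_mapping_eqI)
     (auto simp: Poly_Mapping.lookup_sum lookup_single when_def in_keys_iff)

lemma monomial_span_add: "f \<in> monomial_span S \<Longrightarrow> g \<in> monomial_span S \<Longrightarrow> f + g \<in> monomial_span S"
  unfolding monomial_span_def using keys_add[of f g] by blast

lemma monomial_span_uminus: "f \<in> monomial_span S \<Longrightarrow> - f \<in> monomial_span S"
  unfolding monomial_span_def by (simp add: keys_def)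

lemma monomial_span_zero: "0 \<in> monomial_span S"
  by (simp add: monomial_span_def)

lemma monomial_span_sum: "(\<And>i. i \<in> A \<Longrightarrow> f i \<in> monomial_span S) \<Longrightarrow> sum f A \<in> monomial_span S"
  by (induction A rule: infinite_finite_induct) (auto intro: monomial_span_add monomial_span_zero)

lemma monomial_span_single: "b \<in> S \<Longrightarrow> Poly_Mapping.single b c \<in> monomial_span S"
  by (simp add: monomial_span_def)

lemma monomial_span_mult:
  "f \<in> monomial_span S \<Longrightarrow> g \<in> monomial_span T \<Longrightarrow> (\<And>x y. x \<in> S \<Longrightarrow> y \<in> T \<Longrightarrow> x + y \<in> U)
    \<Longrightarrow> f * g \<in> monomial_span U"
  unfolding monomial_span_def using keys_mult[of f g] by blast

lemma monomial_span_mem_iff: "f \<in> monomial_span S \<longleftrightarrow> (\<forall>k. Poly_Mapping.lookup f k \<noteq> 0 \<longrightarrow> k \<in> S)"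
  by (auto simp: monomial_span_def in_keys_iff)

text \<open>The parameter \<open>kty\<close> only fixes the type of the coefficients.\<close>

locale semigroup_cone =
  fixes C :: "(real ^ 'n) set" and kty :: "'k::field_char_0 itself"
  assumes zero_mem: "0 \<in> lattice_points C"
    and add_mem: "\<mu> \<in> lattice_points C \<Longrightarrow> \<nu> \<in> lattice_points C \<Longrightarrow> \<mu> + \<nu> \<in> lattice_points C"
begin

abbreviation S where "S \<equiv> lattice_points C"
abbreviation R :: "('k, (int ^ 'n) \<Rightarrow>\<^sub>0 'k) module" where "R \<equiv> semigroup_ring C"
abbreviation M :: "((int ^ 'n) \<Rightarrow>\<^sub>0 'k) set" where "M \<equiv> monomial_span S"
abbreviation D where "D \<equiv> diff_ops (ring_of_type_algebra :: 'k ring) R"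

lemma R_simps [simp]:
  "carrier R = M" "mult R = (*)" "one R = 1" "zero R = 0" "add R = (+)"
  "smult R = (\<lambda>c f. Poly_Mapping.single 0 c * f)"
  by (auto simp: semigroup_ring_def)

lemma span_mult: "f \<in> M \<Longrightarrow> g \<in> M \<Longrightarrow> f * g \<in> M"
  by (rule monomial_span_mult) (auto intro: add_mem)

lemma const_mem: "Poly_Mapping.single 0 (c :: 'k) \<in> M"
  by (rule monomial_span_single[OF zero_mem])

lemma cring_R: "cring R"
proof (rule cringI)
  show "abelian_group R"
  proof (rule abelian_groupI)
    fix x assume "x \<in> carrier R"
    then show "\<exists>y\<in>carrier R. y \<oplus>\<^bsub>R\<^esub> x = \<zero>\<^bsub>R\<^esub>"
      by (intro bexI[of _ "- x"]) (auto intro: monomial_span_uminus)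
  qed (auto intro: monomial_span_add monomial_span_zero simp: add_ac)
  show "comm_monoid R"
    by (rule comm_monoidI) (use const_mem[of 1] in \<open>auto intro: span_mult simp: mult_ac\<close>)
qed (simp add: distrib_right)

sublocale cring R by (rule cring_R)

lemma a_inv_R: "f \<in> M \<Longrightarrow> \<ominus>\<^bsub>R\<^esub> f = - f"
  using minus_equality[of "- f" f] monomial_span_uminus[of f S] by simp

lemma a_minus_R: "g \<in> M \<Longrightarrow> f \<ominus>\<^bsub>R\<^esub> g = f - g"
  by (simp add: a_minus_def a_inv_R)

definition K_endo :: "((int ^ 'n \<Rightarrow>\<^sub>0 'k) \<Rightarrow> (int ^ 'n \<Rightarrow>\<^sub>0 'k)) \<Rightarrow> bool" where
  "K_endo \<delta> \<longleftrightarrow> (\<forall>x\<in>M. \<delta> x \<in> M) \<and>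
     (\<forall>x\<in>M. \<forall>y\<in>M. \<delta> (x + y) = \<delta> x + \<delta> y) \<and>
     (\<forall>c. \<forall>x\<in>M. \<delta> (Poly_Mapping.single 0 c * x) = Poly_Mapping.single 0 c * \<delta> x)"

text \<open>\<open>K\<close>-linearity is part of \<open>R\<close>-linearity because the constants
  lie in \<open>M\<close>; recording it lets order zero be treated like the higher orders.\<close>

lemma D_0_iff: "\<delta> \<in> D 0 \<longleftrightarrow> K_endo \<delta> \<and> 
    (\<forall>f\<in>M. \<forall>g\<in>M. \<delta> (f * g) = f * \<delta> g)"
  using const_mem
  by (auto simp: module_endomorphisms_def regular_module_def K_endo_def)

lemma D_Suc_iff: "\<delta> \<in> D (Suc n) \<longleftrightarrow> K_endo \<delta> \<and>
    (\<forall>f\<in>M. (\<lambda>g. \<delta> (f * g) \<ominus>\<^bsub>R\<^esub> f * \<delta> g) \<in> D n)"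
  by (auto simp: module_endomorphisms_def K_endo_def ring_of_type_algebra_def)

lemma D_K_endo: "\<delta> \<in> D n \<Longrightarrow> K_endo \<delta>"
  by (cases n) (auto simp: D_0_iff D_Suc_iff simp del: diff_ops.simps)

lemma K_endo_cong:
  "K_endo \<delta> \<Longrightarrow> (\<And>f. f \<in> M \<Longrightarrow> \<delta>' f = \<delta> f) \<Longrightarrow> K_endo \<delta>'"
  by (auto simp: K_endo_def monomial_span_add span_mult const_mem)

text \<open>Values outside \<open>M\<close> are arbitrary, and the subtraction of \<open>R\<close>
  is known to be that of the type only on \<open>M\<close>. Hence commutators can be written with
  the ordinary minus sign.\<close>

lemma D_cong:
  "\<delta> \<in> D n \<Longrightarrow> (\<And>f. f \<in> M \<Longrightarrow> \<delta>' f = \<delta> f) \<Longrightarrow> \<delta>' \<in> D n"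
proof (induction n arbitrary: \<delta> \<delta>')
  case 0
  then show ?case using K_endo_cong by (auto simp: D_0_iff span_mult simp del: diff_ops.simps)
next
  case (Suc n)
  have "(\<lambda>g. \<delta>' (f * g) \<ominus>\<^bsub>R\<^esub> f * \<delta>' g) \<in> D n" if "f \<in> M" for f
  proof (rule Suc.IH)
    show "(\<lambda>g. \<delta> (f * g) \<ominus>\<^bsub>R\<^esub> f * \<delta> g) \<in> D n"
      using Suc.prems(1) that by (auto simp: D_Suc_iff simp del: diff_ops.simps)
  qed (use Suc.prems(2) that in \<open>auto simp: span_mult\<close>)
  then show ?case using Suc.prems K_endo_cong by (auto simp: D_Suc_iff simp del: diff_ops.simps)
qed

lemma D_SucI:
  assumes "K_endo \<delta>" "\<And>f. f \<in> M \<Longrightarrow> (\<lambda>g. \<delta> (f * g) - f * \<delta> g) \<in> D n"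
  shows "\<delta> \<in> D (Suc n)"
  unfolding D_Suc_iff
proof (intro conjI ballI assms(1))
  fix f assume f: "f \<in> M"
  show "(\<lambda>g. \<delta> (f * g) \<ominus>\<^bsub>R\<^esub> f * \<delta> g) \<in> D n"
    by (rule D_cong[OF assms(2)[OF f]]) (use f assms(1) in \<open>auto simp: a_minus_R span_mult K_endo_def\<close>)
qed

lemma D_SucD:
  assumes "\<delta> \<in> D (Suc n)" "f \<in> M"
  shows "(\<lambda>g. \<delta> (f * g) - f * \<delta> g) \<in> D n"
proof -
  have "(\<lambda>g. \<delta> (f * g) \<ominus>\<^bsub>R\<^esub> f * \<delta> g) \<in> D n" "K_endo \<delta>"
    using assms by (auto simp: D_Suc_iff simp del: diff_ops.simps)
  then show ?thesis
    by (elim D_cong) (use assms(2) in \<open>auto simp: a_minus_R span_mult K_endo_def\<close>)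
qed

lemma D_zero: "(\<lambda>_. 0) \<in> D n"
proof (induction n)
  case 0 show ?case by (auto simp: D_0_iff K_endo_def monomial_span_zero simp del: diff_ops.simps)
next
  case (Suc n) then show ?case 
    by (intro D_SucI) (auto simp: K_endo_def monomial_span_zero simp del: diff_ops.simps)
qed

lemma K_endo_add: "K_endo \<delta> \<Longrightarrow> K_endo \<epsilon> \<Longrightarrow> K_endo (\<lambda>g. \<delta> g + \<epsilon> g)"
  by (auto simp: K_endo_def monomial_span_add algebra_simps)

lemma D_add: "\<delta> \<in> D n \<Longrightarrow> \<epsilon> \<in> D n \<Longrightarrow> (\<lambda>g. \<delta> g + \<epsilon> g) \<in> D n"
proof (induction n arbitrary: \<delta> \<epsilon>)
  case 0 then show ?case by (auto simp: D_0_iff K_endo_add algebra_simps simp del: diff_ops.simps)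
next
  case (Suc n)
  show ?case
  proof (rule D_SucI)
    fix f assume f: "f \<in> M"
    have "(\<lambda>g. (\<delta> (f * g) - f * \<delta> g) + (\<epsilon> (f * g) - f * \<epsilon> g)) \<in> D n"
      using Suc f by (intro Suc.IH D_SucD)
    then show "(\<lambda>g. \<delta> (f * g) + \<epsilon> (f * g) - f * (\<delta> g + \<epsilon> g)) \<in> D n"
      by (simp add: algebra_simps)
  qed (use Suc.prems D_K_endo K_endo_add in blast)
qed

lemma D_sum: "(\<And>i. i \<in> A \<Longrightarrow> \<delta> i \<in> D n) \<Longrightarrow> (\<lambda>g. \<Sum>i\<in>A. \<delta> i g) \<in> D n"
  by (induction A rule: infinite_finite_induct) (auto intro: D_zero D_add simp del: diff_ops.simps)

lemma K_endo_scale: "K_endo \<delta> \<Longrightarrow> K_endo (\<lambda>g. Poly_Mapping.single 0 c * \<delta> g)"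
  using const_mem by (auto simp: K_endo_def span_mult algebra_simps)

lemma D_scale: "\<delta> \<in> D n \<Longrightarrow> (\<lambda>g. Poly_Mapping.single 0 c * \<delta> g) \<in> D n"
proof (induction n arbitrary: \<delta>)
  case 0 then show ?case by (auto simp: D_0_iff mult.left_commute intro: K_endo_scale simp del: diff_ops.simps)
next
  case (Suc n)
  show ?case
  proof (rule D_SucI)
    fix f assume f: "f \<in> M"
    have "(\<lambda>g. Poly_Mapping.single 0 c * (\<delta> (f * g) - f * \<delta> g)) \<in> D n"
      using Suc f by (intro Suc.IH D_SucD)
    then show "(\<lambda>g. Poly_Mapping.single 0 c * \<delta> (f * g) - f * (Poly_Mapping.single 0 c * \<delta> g)) \<in> D n"
      by (simp add: algebra_simps)
  qed (use Suc.prems D_K_endo K_endo_scale in blast)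
qed

lemma K_endo_sum:
  assumes "K_endo \<delta>" "\<And>i. i \<in> A \<Longrightarrow> f i \<in> M"
  shows "\<delta> (sum f A) = (\<Sum>i\<in>A. \<delta> (f i))"
proof -
  have d0: "\<delta> 0 = 0"
    using assms(1) monomial_span_zero[of S] unfolding K_endo_def by (metis add_cancel_right_left)
  show ?thesis using assms(2)
    by (induction A rule: infinite_finite_induct)
       (use assms(1) in \<open>auto simp: d0 K_endo_def monomial_span_sum\<close>)
qed

text \<open>The commutator is \<open>K\<close>-linear in \<open>f\<close>, so the recursive
  condition on differential operators need only be tested on monomials.\<close>

lemma commutator_monomials:
  assumes \<delta>: "K_endo \<delta>" and f: "f \<in> M" and g: "g \<in> M"
  shows "\<delta> (f * g) - f * \<delta> g = (\<Sum>b\<in>Poly_Mapping.keys f. Poly_Mapping.single 0 (Poly_Mapping.lookup f b) *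
     (\<delta> (Poly_Mapping.single b 1 * g) - Poly_Mapping.single b 1 * \<delta> g))"
proof -
  have f': "f = (\<Sum>b\<in>Poly_Mapping.keys f. Poly_Mapping.single 0 (Poly_Mapping.lookup f b) * Poly_Mapping.single b 1)"
    by (subst poly_mapping_sum_single) (simp add: mult_single)
  have keys: "b \<in> Poly_Mapping.keys f \<Longrightarrow> b \<in> S" for b
    using f by (auto simp: monomial_span_def)
  have "\<delta> (f * g) = (\<Sum>b\<in>Poly_Mapping.keys f. \<delta> (Poly_Mapping.single 0 (Poly_Mapping.lookup f b) * (Poly_Mapping.single b 1 * g)))"
    by (subst f', unfold sum_distrib_right, subst K_endo_sum[OF \<delta>])
       (auto simp: mult.assoc intro!: span_mult monomial_span_single zero_mem keys g)
  also have "\<dots> = (\<Sum>b\<in>Poly_Mapping.keys f. Poly_Mapping.single 0 (Poly_Mapping.lookup f b) * \<delta> (Poly_Mapping.single b 1 * g))"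
    using \<delta> by (intro sum.cong refl) (auto simp: K_endo_def intro!: span_mult monomial_span_single keys g)
  moreover have "f * \<delta> g = (\<Sum>b\<in>Poly_Mapping.keys f. Poly_Mapping.single 0 (Poly_Mapping.lookup f b) * (Poly_Mapping.single b 1 * \<delta> g))"
    by (subst f', unfold sum_distrib_right) (simp add: mult.assoc)
  ultimately show ?thesis by (simp add: sum_subtractf right_diff_distrib)
qed

lemma D_0_monomialI:
  assumes "K_endo \<delta>"
    and "\<And>b g. b \<in> S \<Longrightarrow> g \<in> M \<Longrightarrow>
      \<delta> (Poly_Mapping.single b 1 * g) = Poly_Mapping.single b 1 * \<delta> g"
  shows "\<delta> \<in> D 0"
  unfolding D_0_iff
proof (intro conjI ballI assms(1))
  fix f g assume fg: "f \<in> M" "g \<in> M"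
  have "\<delta> (f * g) - f * \<delta> g = 0"
    by (subst commutator_monomials[OF assms(1) fg])
       (use fg assms(2) in \<open>auto simp: monomial_span_def intro!: sum.neutral\<close>)
  then show "\<delta> (f * g) = f * \<delta> g" by simp
qed

lemma D_Suc_monomialI:
  assumes "K_endo \<delta>"
    and "\<And>b. b \<in> S \<Longrightarrow> (\<lambda>g. \<delta> (Poly_Mapping.single b 1 * g) - Poly_Mapping.single b 1 * \<delta> g) \<in> D n"
  shows "\<delta> \<in> D (Suc n)"
proof (rule D_SucI[OF assms(1)])
  fix f assume f: "f \<in> M"
  have "(\<lambda>g. \<Sum>b\<in>Poly_Mapping.keys f. Poly_Mapping.single 0 (Poly_Mapping.lookup f b) *
     (\<delta> (Poly_Mapping.single b 1 * g) - Poly_Mapping.single b 1 * \<delta> g)) \<in> D n"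
    using f by (intro D_sum D_scale assms(2)) (auto simp: monomial_span_def)
  then show "(\<lambda>g. \<delta> (f * g) - f * \<delta> g) \<in> D n"
    by (rule D_cong) (rule commutator_monomials[OF assms(1) f])
qed

end

section \<open>Monomial operators and the coefficients of a general operator\<close>

definition monomial_operator ::
    "'a::ab_group_add \<Rightarrow> ('a \<Rightarrow> 'k::comm_ring_1) \<Rightarrow> ('a \<Rightarrow>\<^sub>0 'k) \<Rightarrow> ('a \<Rightarrow>\<^sub>0 'k)" where
  "monomial_operator a p f =
     (\<Sum>\<nu>\<in>Poly_Mapping.keys f. Poly_Mapping.single (\<nu> + a) (p \<nu> * Poly_Mapping.lookup f \<nu>))"

lemma lookup_monomial_operator [simp]:
  "Poly_Mapping.lookup (monomial_operator a p f) k = p (k - a) * Poly_Mapping.lookup f (k - a)"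
proof -
  have "Poly_Mapping.lookup (monomial_operator a p f) k = 
     (\<Sum>\<nu>\<in>Poly_Mapping.keys f. if \<nu> = k - a then p \<nu> * Poly_Mapping.lookup f \<nu> else 0)"
    unfolding monomial_operator_def Poly_Mapping.lookup_sum
    by (intro sum.cong refl) (auto simp: lookup_single when_def)
  also have "\<dots> = p (k - a) * Poly_Mapping.lookup f (k - a)"
    by (simp add: in_keys_iff)
  finally show ?thesis .
qed

context semigroup_cone
begin

lemma K_endo_monomial_operator:
  assumes "\<And>\<nu>. \<nu> \<in> S \<Longrightarrow> \<nu> + a \<notin> S \<Longrightarrow> p \<nu> = 0"
  shows "K_endo (monomial_operator a p)"
  unfolding K_endo_def
proof (intro conjI ballI allI)
  fix f assume "f \<in> M"
  then show "monomial_operator a p f \<in> M"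
    using assms[of "k - a" for k] by (force simp: monomial_span_mem_iff)
qed (rule poly_mapping_eqI, simp add: lookup_add lookup_single_times distrib_left mult.left_commute)+

text \<open>This identity ties the order of an operator to the difference degree of its coefficient
  function.\<close>

lemma commutator_monomial_operator:
  "monomial_operator a p (Poly_Mapping.single b 1 * g) - Poly_Mapping.single b 1 * monomial_operator a p g =
   monomial_operator (a + b) (\<lambda>x. p (x + b) - p x) g"
  by (rule poly_mapping_eqI) (simp add: lookup_minus lookup_single_times, simp add: algebra_simps)

text \<open>Each commutator lowers the degree by one; \<open>Suc n\<close> stands for degree at most
  \<open>n\<close>. The vanishing condition survives because \<open>\<nu> + a\<close> in
  \<open>S\<close> would put \<open>\<nu> + a + b\<close> in \<open>S\<close>.\<close>

lemma monomial_operator_mem_D: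
  assumes "diff_deg_less (Suc n) p" and "\<And>\<nu>. \<nu> \<in> S \<Longrightarrow> \<nu> + a \<notin> S \<Longrightarrow> p \<nu> = 0"
  shows "monomial_operator a p \<in> D n"
  using assms
proof (induction n arbitrary: a p)
  case 0
  then show ?case
    by (intro D_0_monomialI K_endo_monomial_operator)
       (auto simp: eq_iff_diff_eq_0[of "monomial_operator a p _"] commutator_monomial_operator intro: poly_mapping_eqI)
next
  case (Suc n)
  show ?case
  proof (rule D_Suc_monomialI)
    fix b assume b: "b \<in> S"
    show "(\<lambda>g. monomial_operator a p (Poly_Mapping.single b 1 * g) - Poly_Mapping.single b 1 * monomial_operator a p g) \<in> D n"
      unfolding commutator_monomial_operator
    proof (rule Suc.IH)
      fix \<nu> assume \<nu>: "\<nu> \<in> S" "\<nu> + (a + b) \<notin> S"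
      have "\<nu> + b \<in> S" "\<nu> + b + a \<notin> S" "\<nu> + a \<notin> S"
        using \<nu> b add_mem[of "\<nu> + a" b] by (auto simp: add_ac intro: add_mem)
      then show "p (\<nu> + b) - p \<nu> = 0" using \<nu> Suc.prems(2) by simp
    qed (use Suc.prems(1) in simp)
  qed (use Suc.prems K_endo_monomial_operator in blast)
qed

text \<open>Coefficients of a fixed shift are enough, so \<open>\<delta>\<close> need not be
  decomposed into homogeneous parts. The shift \<open>a\<close> is arbitrary because commuting with
  the monomial of exponent \<open>b\<close> turns it into \<open>a + b\<close>. The claim is
  restricted to \<open>S\<close> since only there is the monomial in the ring.\<close>

lemma D_coefficient_diff_deg_less_on:
  "\<delta> \<in> D n \<Longrightarrow> diff_deg_less_on S (Suc n) (\<lambda>\<nu>. Poly_Mapping.lookup (\<delta> (Poly_Mapping.single \<nu> 1)) (\<nu> + a))"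
proof (induction n arbitrary: \<delta> a)
  case 0
  have "\<delta> (Poly_Mapping.single (x + b) 1) = Poly_Mapping.single b 1 * \<delta> (Poly_Mapping.single x 1)"
    if "x \<in> S" "b \<in> S" for x b
    using 0 that unfolding D_0_iff
    by (metis add.commute monomial_span_single mult_1 mult_single)
  then have "Poly_Mapping.lookup (\<delta> (Poly_Mapping.single (x + b) 1)) (x + b + a) =
      Poly_Mapping.lookup (\<delta> (Poly_Mapping.single x 1)) (x + a)" if "x \<in> S" "b \<in> S" for x b
    using that by (simp add: lookup_single_times add_diff_eq[symmetric] add.assoc)
  then show ?case by simp
next
  case (Suc n)
  show ?case
    unfolding diff_deg_less_on.simps(2)[of S "Suc n"]
  proof
    fix b assume b: "b \<in> S"
    have "diff_deg_less_on S (Suc n) (\<lambda>\<nu>. Poly_Mapping.lookup (\<delta> (Poly_Mapping.single b 1 * Poly_Mapping.single \<nu> 1)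
         - Poly_Mapping.single b 1 * \<delta> (Poly_Mapping.single \<nu> 1)) (\<nu> + (a + b)))"
      by (rule Suc.IH) (rule D_SucD[OF Suc.prems monomial_span_single[OF b]])
    then show "diff_deg_less_on S (Suc n) (\<lambda>\<nu>. Poly_Mapping.lookup (\<delta> (Poly_Mapping.single (\<nu> + b) 1)) (\<nu> + b + a) -
         Poly_Mapping.lookup (\<delta> (Poly_Mapping.single \<nu> 1)) (\<nu> + a))"
      by (simp add: mult_single lookup_minus lookup_single_times add_ac del: diff_deg_less_on.simps)
  qed
qed

end

section \<open>Cones described by integral facet forms\<close>

lemma additive_scale: "Modules.additive (\<lambda>t. t *s (e :: int ^ 'n))"
  by (simp add: Modules.additive_def vector_sadd_rdistrib)

lemma additive_int_scale:
  fixes f :: "int ^ 'n \<Rightarrow> int"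
  assumes "Modules.additive f"
  shows "f (t *s e) = t * f e"
proof -
  interpret Modules.additive f by fact
  have step: "f ((t + 1) *s e) = f (t *s e) + f e" for t
    by (simp add: vector_sadd_rdistrib add)
  show ?thesis
  proof (induction t rule: int_induct[of _ 0])
    case (step1 i) then show ?case using step[of i] by (simp add: algebra_simps)
  next
    case (step2 i) then show ?case using step[of "i - 1"] by (simp add: algebra_simps)
  qed (simp add: zero)
qed

lemma diff_deg_less_prod_affine:
  fixes b :: "'i \<Rightarrow> 'a::ab_group_add \<Rightarrow> 'k::comm_ring_1"
  assumes "finite A" "\<And>i. i \<in> A \<Longrightarrow> Modules.additive (b i)"
  shows "diff_deg_less (Suc (card A)) (\<lambda>x. \<Prod>i\<in>A. b i x + c i)"
  using assms
proof (induction A rule: finite_induct)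
  case (insert i A)
  then have "diff_deg_less (Suc (Suc (card A))) (\<lambda>x. (b i x + c i) * (\<Prod>i\<in>A. b i x + c i))"
    by (intro diff_deg_less_mult_affine) auto
  with insert.hyps show ?case by simp
qed simp

text \<open>What the algebra needs from the geometry, expressed by integer values of the facet
  forms. The value \<open>1\<close> in \<open>primitive\<close> reflects coprime coefficients and
  gives the transversal direction for division; the vector in \<open>facet_point\<close> runs
  parallel to the walls of facet \<open>i\<close> and into the cone for all other facets.\<close>

locale facet_cone =
  fixes C :: "(real ^ 'n) set" and kty :: "'k::field_char_0 itself"
    and I :: "'i set" and a :: "'i \<Rightarrow> int ^ 'n \<Rightarrow> int"
  assumes finite_I: "finite I"
    and additive_a: "i \<in> I \<Longrightarrow> Modules.additive (a i)"
    and mem_iff: "\<mu> \<in> lattice_points C \<longleftrightarrow> (\<forall>i\<in>I. a i \<mu> \<ge> 0)"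
    and primitive: "i \<in> I \<Longrightarrow> \<exists>e. a i e = 1"
    and facet_point: "i \<in> I \<Longrightarrow> \<exists>u. a i u = 0 \<and> (\<forall>k\<in>I - {i}. a k u > 0)"
    and interior_point: "\<exists>w. \<forall>i\<in>I. a i w > 0"
    and pointed: "(\<forall>i\<in>I. a i \<mu> = 0) \<Longrightarrow> \<mu> = 0"
begin

lemma a_add: "i \<in> I \<Longrightarrow> a i (x + y) = a i x + a i y"
  and a_diff: "i \<in> I \<Longrightarrow> a i (x - y) = a i x - a i y"
  and a_zero: "i \<in> I \<Longrightarrow> a i 0 = 0"
  and a_scale: "i \<in> I \<Longrightarrow> a i (t *s x) = t * a i x"
  using Modules.additive.add[OF additive_a] Modules.additive.diff[OF additive_a]
    Modules.additive.zero[OF additive_a] additive_int_scale[OF additive_a] by auto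

sublocale semigroup_cone C kty
  by unfold_locales (auto simp: mem_iff a_zero a_add)

definition ht :: "int ^ 'n \<Rightarrow> int" where "ht \<mu> = (\<Sum>i\<in>I. a i \<mu>)"

lemma ht_add: "ht (\<mu> + \<nu>) = ht \<mu> + ht \<nu>"
  by (simp add: ht_def a_add sum.distrib)

lemma ht_nonneg: "\<mu> \<in> S \<Longrightarrow> ht \<mu> \<ge> 0"
  by (simp add: ht_def mem_iff sum_nonneg)

lemma ht_pos: "\<mu> \<in> S \<Longrightarrow> \<mu> \<noteq> 0 \<Longrightarrow> ht \<mu> > 0"
  unfolding ht_def using sum_nonneg_eq_0_iff[OF finite_I, of "\<lambda>i. a i \<mu>"] pointed[of \<mu>] ht_nonneg[of \<mu>]
  by (force simp: mem_iff ht_def)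

text \<open>One threshold serves all facets: a positive \<open>a k u\<close> is an integer, hence at
  least \<open>1\<close>, so \<open>t\<close> times it dominates
  \<open>\<bar>a k x\<bar>\<close>.\<close>

lemma eventually_mem:
  assumes "\<And>k. k \<in> I \<Longrightarrow> a k u > 0 \<or> a k u = 0 \<and> a k x \<ge> 0"
  obtains T where "T \<ge> 0" "\<And>t. t \<ge> T \<Longrightarrow> x + t *s u \<in> S"
proof (rule that[of "\<Sum>k\<in>I. \<bar>a k x\<bar>"])
  fix t assume t: "t \<ge> (\<Sum>k\<in>I. \<bar>a k x\<bar>)"
  have "a k x + t * a k u \<ge> 0" if k: "k \<in> I" for k
  proof -
    have "\<bar>a k x\<bar> \<le> t"
      using member_le_sum[OF k, of "\<lambda>k. \<bar>a k x\<bar>"] finite_I t by force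
    moreover from this have "t * 1 \<le> t * a k u" if "a k u > 0"
      using that by (intro mult_left_mono) auto
    ultimately show ?thesis using assms[OF k] by auto
  qed
  then show "x + t *s u \<in> S" by (simp add: mem_iff a_add a_scale)
qed (simp add: sum_nonneg)

text \<open>From any point an interior direction eventually stays in \<open>S\<close>. This is the
  uniqueness required for extending coefficient functions.\<close>

lemma diff_deg_less_zero_on_S:
  fixes g :: "int ^ 'n \<Rightarrow> 'b::ab_group_add"
  assumes "diff_deg_less n g" "\<And>s. s \<in> S \<Longrightarrow> g s = 0"
  shows "g x = 0"
proof -
  obtain w where w: "\<forall>i\<in>I. a i w > 0" using interior_point by blast
  obtain T where T: "\<And>t. t \<ge> T \<Longrightarrow> x + t *s w \<in> S"
    using eventually_mem[of w x] w by metis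
  show ?thesis
    by (rule diff_deg_less_ray_eq_0[OF additive_scale[of w] assms(1), of T]) (rule assms(2)[OF T])
qed

lemma translate_into_S: "\<exists>u\<in>S. x + u \<in> S"
proof -
  obtain w where w: "\<forall>i\<in>I. a i w > 0" using interior_point by blast
  obtain T where T: "T \<ge> 0" "\<And>t. t \<ge> T \<Longrightarrow> x + t *s w \<in> S"
    using eventually_mem[of w x] w by metis
  have "T *s w \<in> S"
    unfolding mem_iff using T(1) w by (simp add: a_scale less_imp_le)
  then show ?thesis using T(2)[of T] by blast
qed

text \<open>One index set for both inclusions: its pairs \<open>(i, j)\<close> are the factors of
  the polynomial that builds an operator, and the hyperplanes on which coefficient functions of
  shift \<open>- \<mu>\<close> vanish.\<close>

definition walls :: "int ^ 'n \<Rightarrow> ('i \<times> int) set" where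
  "walls \<mu> = (SIGMA i:I. {0..<a i \<mu>})"

lemma card_walls: "\<mu> \<in> S \<Longrightarrow> int (card (walls \<mu>)) = ht \<mu>"
  by (simp add: walls_def finite_I ht_def mem_iff)

lemma finite_walls: "finite (walls \<mu>)"
  by (simp add: walls_def finite_I)

text \<open>Walls of different facets must not be counted as the same hyperplane; otherwise their
  number could fall below \<open>ht \<mu>\<close>.\<close>

lemma inj_on_a: "inj_on a I"
proof (rule inj_onI, rule ccontr)
  fix i k assume ik: "i \<in> I" "k \<in> I" "a i = a k" "i \<noteq> k"
  then show False using facet_point[of i] by force
qed

lemma D_constant_term_eq_0:
  assumes \<delta>: "\<delta> \<in> D n" and \<mu>: "\<mu> \<in> S" and n: "int n < ht \<mu>"
  shows "Poly_Mapping.lookup (\<delta> (Poly_Mapping.single \<mu> 1)) 0 = 0"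
proof -
  \<comment> \<open>At \<open>\<nu> = \<mu>\<close> this is the constant term in question.\<close>
  define f where "f \<nu> = Poly_Mapping.lookup (\<delta> (Poly_Mapping.single \<nu> 1)) (\<nu> + - \<mu>)" for \<nu>
  have "diff_deg_less_on S (Suc n) f"
    unfolding f_def[abs_def] by (rule D_coefficient_diff_deg_less_on[OF \<delta>])
  then obtain g where g: "diff_deg_less (Suc n) g" "\<And>x. x \<in> S \<Longrightarrow> g x = f x"
    using diff_deg_less_on_extend[of S "Suc n" f, OF zero_mem add_mem translate_into_S]
      diff_deg_less_zero_on_S by blast
  have f0: "f x = 0" if "x \<in> S" "x - \<mu> \<notin> S" for x
  proof -
    have "\<delta> (Poly_Mapping.single x 1) \<in> M"
      using D_K_endo[OF \<delta>] monomial_span_single[OF that(1)] by (auto simp: K_endo_def)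
    then show ?thesis using that(2) by (auto simp: f_def monomial_span_mem_iff)
  qed
  define H where "H = (\<lambda>(i, j). (a i, j)) ` walls \<mu>"
  have "inj_on (\<lambda>(i, j). (a i, j)) (walls \<mu>)"
    using inj_on_a by (auto simp: inj_on_def walls_def)
  then have card: "card H = card (walls \<mu>)" unfolding H_def by (rule card_image)
  have "g \<mu> = 0"
  proof (rule diff_deg_less_hyperplanes_eq_0[OF _ _ g(1)])
    show "finite H" by (simp add: H_def finite_walls)
    show "Suc n \<le> card H" using card_walls[OF \<mu>] n by (simp add: card)
  next
    fix b j assume "(b, j) \<in> H"
    then obtain i where "i \<in> I" "b = a i" by (auto simp: H_def walls_def)
    then show "Modules.additive b \<and> (\<exists>\<iota>::int \<Rightarrow> int ^ 'n. Modules.additive \<iota> \<and> b (\<iota> 1) = 1)"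
      using additive_a primitive additive_scale by (metis vector_smult_lid)
  next
    fix b j b' j' assume "(b, j) \<in> H" "(b', j') \<in> H" "b \<noteq> b'"
    then obtain i i' where "i \<in> I" "i' \<in> I" "i \<noteq> i'" "b = a i" "b' = a i'"
      by (auto simp: H_def walls_def)
    moreover from this obtain u where "a i' u = 0" "a i u > 0" using facet_point[of i'] by blast
    ultimately show "\<exists>\<iota>::int \<Rightarrow> int ^ 'n. Modules.additive \<iota> \<and> b' (\<iota> 1) = 0 \<and> b (\<iota> 1) \<noteq> 0"
      using additive_scale[of u] by (intro exI[of _ "\<lambda>t. t *s u"]) auto
  next
    fix b j x assume "(b, j) \<in> H" "b x = j"
    then obtain i where i: "i \<in> I" "b = a i" "0 \<le> a i x" "a i x < a i \<mu>" 
      by (auto simp: H_def walls_def)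
    \<comment> \<open>\<open>x\<close> lies on a wall but perhaps outside \<open>S\<close>. Moving
      along \<open>u\<close> fixes \<open>a i\<close> and pushes the other forms up, so far out the
      points are in \<open>S\<close>, while subtracting \<open>\<mu>\<close> makes
      \<open>a i\<close> negative.\<close>
    obtain u where u: "a i u = 0" "\<forall>k\<in>I - {i}. a k u > 0" using facet_point[OF i(1)] by blast
    obtain T where T: "\<And>t. t \<ge> T \<Longrightarrow> x + t *s u \<in> S"
      using eventually_mem[of u x] u i by (metis Diff_iff singletonD)
    show "g x = 0"
    proof (rule diff_deg_less_ray_eq_0[OF additive_scale[of u] g(1)])
      fix t assume "t \<ge> T"
      moreover have "x + t *s u - \<mu> \<notin> S"
        using i u by (auto simp: mem_iff a_add a_diff a_scale intro!: bexI[of _ i])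
      ultimately show "g (x + t *s u) = 0" using f0 g(2) T by simp
    qed
  qed
  then show ?thesis using g(2)[OF \<mu>] by (simp add: f_def)
qed

lemma exists_D_constant_term_ne_0:
  assumes \<mu>: "\<mu> \<in> S" and n: "ht \<mu> \<le> int n"
  obtains \<delta> c where "\<delta> \<in> D n" "c \<noteq> 0"
    "\<And>f. Poly_Mapping.lookup (\<delta> f) 0 = c * Poly_Mapping.lookup f \<mu>"
proof -
  define p :: "int ^ 'n \<Rightarrow> 'k" where "p \<nu> = (\<Prod>(i, j)\<in>walls \<mu>. of_int (a i \<nu>) + of_int (- j))" for \<nu>
  have "diff_deg_less (Suc (card (walls \<mu>))) p"
    unfolding p_def[abs_def] case_prod_beta
    by (rule diff_deg_less_prod_affine[OF finite_walls])
       (auto simp: walls_def Modules.additive_def a_add)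
  moreover have "Suc (card (walls \<mu>)) \<le> Suc n" using card_walls[OF \<mu>] n by simp
  ultimately have deg: "diff_deg_less (Suc n) p" using diff_deg_less_mono by blast
  have p0: "p \<nu> = 0" if \<nu>: "\<nu> \<in> S" "\<nu> + - \<mu> \<notin> S" for \<nu>
  proof -
    \<comment> \<open>Leaving the cone means that some \<open>a i \<nu>\<close> is below
      \<open>a i \<mu>\<close>; then the factor of index \<open>(i, a i \<nu>)\<close> vanishes at
      \<open>\<nu>\<close>.\<close>
    obtain i where "i \<in> I" "a i \<nu> < a i \<mu>" "a i \<nu> \<ge> 0" using \<nu> by (auto simp: mem_iff a_diff)
    then show ?thesis unfolding p_def
      by (intro prod_zero finite_walls bexI[of _ "(i, a i \<nu>)"]) (auto simp: walls_def)
  qed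
  \<comment> \<open>At \<open>\<mu>\<close> each factor is a positive integer, nonzero in
    characteristic zero.\<close>
  have "p \<mu> \<noteq> 0"
    unfolding p_def using finite_walls by (auto simp: walls_def)
  moreover have "monomial_operator (- \<mu>) p \<in> D n"
    using deg p0 by (rule monomial_operator_mem_D)
  ultimately show ?thesis
    by (intro that[of "monomial_operator (- \<mu>) p" "p \<mu>"]) auto
qed

text \<open>The operator built for \<open>\<mu>\<close> reads off the coefficient at
  \<open>\<mu>\<close> alone, so a single term of low height excludes \<open>f\<close>, whatever its
  other terms. The operators have order \<open>n - 1\<close>, so constant terms vanish from height
  \<open>n\<close> on.\<close>

lemma diff_power_eq:
  assumes "n \<ge> 1"
  shows "diff_power (ring_of_type_algebra :: 'k ring) R (homogeneous_max_ideal C) n =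
    monomial_span {\<mu> \<in> S. ht \<mu> \<ge> int n}"
proof (intro Set.set_eqI iffI)
  fix f assume f: "f \<in> diff_power (ring_of_type_algebra :: 'k ring) R (homogeneous_max_ideal C) n"
  then have fM: "f \<in> M" by (simp add: diff_power_def)
  have "ht \<mu> \<ge> int n" if \<mu>: "Poly_Mapping.lookup f \<mu> \<noteq> 0" for \<mu>
  proof (rule ccontr)
    assume "\<not> ht \<mu> \<ge> int n"
    then have "ht \<mu> \<le> int (n - 1)" using assms by simp
    moreover have "\<mu> \<in> S" using fM \<mu> by (auto simp: monomial_span_mem_iff)
    ultimately obtain \<delta> c where \<delta>: "\<delta> \<in> D (n - 1)" "c \<noteq> 0"
        "\<And>f. Poly_Mapping.lookup (\<delta> f) 0 = c * Poly_Mapping.lookup f \<mu>"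
      using exists_D_constant_term_ne_0 by metis
    then have "\<delta> f \<in> homogeneous_max_ideal C" using f by (simp add: diff_power_def)
    then have "Poly_Mapping.lookup (\<delta> f) 0 = 0"
      unfolding homogeneous_max_ideal_def monomial_span_mem_iff by blast
    then show False using \<delta>(2,3) \<mu> by auto
  qed
  then show "f \<in> monomial_span {\<mu> \<in> S. ht \<mu> \<ge> int n}"
    using fM by (auto simp: monomial_span_mem_iff)
next
  fix f :: "int ^ 'n \<Rightarrow>\<^sub>0 'k" assume f: "f \<in> monomial_span {\<mu> \<in> S. ht \<mu> \<ge> int n}"
  then have fM: "f \<in> M" by (auto simp: monomial_span_def)
  have "\<delta> f \<in> homogeneous_max_ideal C" if \<delta>: "\<delta> \<in> D (n - 1)" for \<delta>
  proof -
    have endo: "K_endo \<delta>" by (rule D_K_endo[OF \<delta>])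
    have keys: "\<mu> \<in> S \<and> int (n - 1) < ht \<mu>" if "\<mu> \<in> Poly_Mapping.keys f" for \<mu>
      using f that assms by (auto simp: monomial_span_def)
    have "\<delta> f = (\<Sum>b\<in>Poly_Mapping.keys f. \<delta> (Poly_Mapping.single 0 (Poly_Mapping.lookup f b) * Poly_Mapping.single b 1))"
      by (subst poly_mapping_sum_single[of f], subst K_endo_sum[OF endo])
         (use keys in \<open>auto simp: mult_single monomial_span_single\<close>)
    also have "\<dots> = (\<Sum>b\<in>Poly_Mapping.keys f. Poly_Mapping.single 0 (Poly_Mapping.lookup f b) * \<delta> (Poly_Mapping.single b 1))"
      using endo keys by (intro sum.cong refl) (auto simp: K_endo_def monomial_span_single)
    finally have "Poly_Mapping.lookup (\<delta> f) 0 = 0"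
      using D_constant_term_eq_0[OF \<delta>] keys
      by (simp add: Poly_Mapping.lookup_sum lookup_single_times)
    moreover have "\<delta> f \<in> M" using endo fM by (auto simp: K_endo_def)
    ultimately show ?thesis by (auto simp: homogeneous_max_ideal_def monomial_span_mem_iff)
  qed
  with fM show "f \<in> diff_power (ring_of_type_algebra :: 'k ring) R (homogeneous_max_ideal C) n"
    by (simp add: diff_power_def)
qed

end

section \<open>Length of the quotients\<close>

context semigroup_cone
begin

text \<open>Submodules are subspaces over \<open>K\<close>; this provides the linear algebra that
  bounds chains.\<close>

lemma vector_space_scale: "vector_space (\<lambda>c (f :: int ^ 'n \<Rightarrow>\<^sub>0 'k). Poly_Mapping.single 0 c * f)"
  by unfold_locales
     (simp_all add: distrib_left distrib_right single_add mult.assoc[symmetric] mult_single)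

lemma ideal_monomial_span:
  assumes T: "T \<subseteq> S" "\<And>x y. x \<in> T \<Longrightarrow> y \<in> S \<Longrightarrow> x + y \<in> T"
  shows "ideal (monomial_span T :: (int ^ 'n \<Rightarrow>\<^sub>0 'k) set) R"
proof (rule idealI)
  have TM: "monomial_span T \<subseteq> M" using T(1) by (auto simp: monomial_span_def)
  show "ring R" by (rule ring_axioms)
  show "subgroup (monomial_span T) (add_monoid R)"
  proof (rule group.subgroupI[OF a_group])
    fix f :: "int ^ 'n \<Rightarrow>\<^sub>0 'k" assume f: "f \<in> monomial_span T"
    then have "inv\<^bsub>add_monoid R\<^esub> f = - f"
      using a_inv_R TM by (auto simp: a_inv_def)
    then show "inv\<^bsub>add_monoid R\<^esub> f \<in> monomial_span T"
      using monomial_span_uminus[OF f] by simp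
  qed (use TM monomial_span_zero[where 'b='k, of T] monomial_span_add[where 'b='k] in auto)
  fix f g :: "int ^ 'n \<Rightarrow>\<^sub>0 'k" assume "f \<in> monomial_span T" "g \<in> carrier R"
  then have "f * g \<in> monomial_span T"
    using T(2) by (intro monomial_span_mult[of f T g S]) auto
  then show "g \<otimes>\<^bsub>R\<^esub> f \<in> monomial_span T" "f \<otimes>\<^bsub>R\<^esub> g \<in> monomial_span T"
    by (simp_all add: mult.commute)
qed

context
  fixes T assumes T: "T \<subseteq> S" "\<And>x y. x \<in> T \<Longrightarrow> y \<in> S \<Longrightarrow> x + y \<in> T"
begin

abbreviation J :: "(int ^ 'n \<Rightarrow>\<^sub>0 'k) set" where "J \<equiv> monomial_span T"
abbreviation Q where "Q \<equiv> quotient_module R J"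

interpretation J: ideal J R by (rule ideal_monomial_span[OF T])

lemma Q_simps [simp]:
  "carrier Q = (\<lambda>f. J +>\<^bsub>R\<^esub> f) ` M" "zero Q = J" "add Q = add (R Quot J)"
  "smult Q = (\<lambda>r A. (J +>\<^bsub>R\<^esub> r) \<otimes>\<^bsub>R Quot J\<^esub> A)"
  by (auto simp: quotient_module_def FactRing_def A_RCOSETS_def')

lemma group_Q: "group (add_monoid Q)"
proof -
  have "comm_group (add_monoid (R Quot J))"
    using J.quotient_is_ring unfolding ring_def abelian_group_def abelian_group_axioms_def by blast
  then have "group (add_monoid (R Quot J))" unfolding comm_group_def by blast
  then show ?thesis
    unfolding group_def group_axioms_def Group.monoid_def Units_def
    by (simp add: quotient_module_def)
qed

lemma coset_add: "f \<in> M \<Longrightarrow> g \<in> M \<Longrightarrow> (J +>\<^bsub>R\<^esub> f) \<oplus>\<^bsub>R Quot J\<^esub> (J +>\<^bsub>R\<^esub> g) = J +>\<^bsub>R\<^esub> (f + g)"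
  using J.a_rcos_sum[of f g] by (simp add: FactRing_def)

lemma coset_mult: "f \<in> M \<Longrightarrow> g \<in> M \<Longrightarrow> (J +>\<^bsub>R\<^esub> f) \<otimes>\<^bsub>R Quot J\<^esub> (J +>\<^bsub>R\<^esub> g) = J +>\<^bsub>R\<^esub> (f * g)"
  using J.rcoset_mult_add[of f g] by (simp add: FactRing_def)

lemma coset_eq_iff: "f \<in> M \<Longrightarrow> g \<in> M \<Longrightarrow> J +>\<^bsub>R\<^esub> f = J +>\<^bsub>R\<^esub> g \<longleftrightarrow> f - g \<in> J"
  using quotient_eq_iff_same_a_r_cos[OF J.ideal_axioms, of f g] by (simp add: a_minus_R)

lemma coset_zero: "J +>\<^bsub>R\<^esub> 0 = J"
  by (simp add: a_r_coset_def')

lemma submodule_of_monoid_ideal: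
  assumes T': "T' \<subseteq> S" "\<And>x y. x \<in> T' \<Longrightarrow> y \<in> S \<Longrightarrow> x + y \<in> T'"
  shows "submodule ((\<lambda>f. J +>\<^bsub>R\<^esub> f) ` monomial_span T') R Q"
proof (intro submodule.intro group.subgroupI[OF group_Q] submodule_axioms.intro)
  have TM: "monomial_span T' \<subseteq> M" using T'(1) by (auto simp: monomial_span_def)
  show "(+>\<^bsub>R\<^esub>) J ` monomial_span T' \<subseteq> carrier (add_monoid Q)" using TM by auto
  show "(+>\<^bsub>R\<^esub>) J ` monomial_span T' \<noteq> {}" using monomial_span_zero by blast
  show "x \<otimes>\<^bsub>add_monoid Q\<^esub> y \<in> (+>\<^bsub>R\<^esub>) J ` monomial_span T'"
    if xy: "x \<in> (+>\<^bsub>R\<^esub>) J ` monomial_span T'" "y \<in> (+>\<^bsub>R\<^esub>) J ` monomial_span T'" for x y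
  proof -
    obtain f g where fg: "f \<in> monomial_span T'" "g \<in> monomial_span T'" "x = J +>\<^bsub>R\<^esub> f" "y = J +>\<^bsub>R\<^esub> g"
      using xy by blast
    then have "f \<in> M" "g \<in> M" using TM by auto
    then show ?thesis using fg by (simp add: coset_add monomial_span_add)
  qed
  show "inv\<^bsub>add_monoid Q\<^esub> x \<in> (+>\<^bsub>R\<^esub>) J ` monomial_span T'"
    if x: "x \<in> (+>\<^bsub>R\<^esub>) J ` monomial_span T'" for x
  proof -
    obtain f where f: "f \<in> monomial_span T'" "x = J +>\<^bsub>R\<^esub> f" using x by blast
    have fM: "f \<in> M" "- f \<in> M" using f TM monomial_span_uminus[of f S] by auto
    have "inv\<^bsub>add_monoid Q\<^esub> x = J +>\<^bsub>R\<^esub> (- f)"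
    proof (rule group.inv_equality[OF group_Q])
      show "(J +>\<^bsub>R\<^esub> (- f)) \<otimes>\<^bsub>add_monoid Q\<^esub> x = \<one>\<^bsub>add_monoid Q\<^esub>"
        using coset_add[OF fM(2,1)] by (simp add: f(2) coset_zero)
    qed (use fM f in auto)
    then show ?thesis using monomial_span_uminus[OF f(1)] by blast
  qed
  show "r \<odot>\<^bsub>Q\<^esub> x \<in> (+>\<^bsub>R\<^esub>) J ` monomial_span T'"
    if r: "r \<in> carrier R" and x: "x \<in> (+>\<^bsub>R\<^esub>) J ` monomial_span T'" for r x
  proof -
    obtain f where f: "f \<in> monomial_span T'" "x = J +>\<^bsub>R\<^esub> f" using x by blast
    have "r * f \<in> monomial_span T'"
      using T'(2) r f by (subst mult.commute, intro monomial_span_mult[of f T' r S]) auto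
    moreover have "f \<in> M" "r \<in> M" using TM f r by auto
    ultimately show ?thesis using f(2) by (simp add: coset_mult)
  qed
qed

text \<open>The chain adds one exponent at a time, always one of maximal height \<open>h\<close>.\<close>

lemma monoid_ideal_chain:
  assumes fin: "finite (S - T')" and T': "T \<subseteq> T'" "T' \<subseteq> S" "\<And>x y. x \<in> T' \<Longrightarrow> y \<in> S \<Longrightarrow> x + y \<in> T'"
    and h: "\<And>x y. x \<in> S \<Longrightarrow> y \<in> S \<Longrightarrow> y \<noteq> 0 \<Longrightarrow> (h (x + y) :: int) > h x"
  shows "\<exists>U. (\<forall>i \<le> card (S - T'). T \<subseteq> U i \<and> U i \<subseteq> S \<and> (\<forall>x\<in>U i. \<forall>y\<in>S. x + y \<in> U i)) \<and>
     (\<forall>i < card (S - T'). U i \<subset> U (Suc i))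
    \<and> U 0 = T'"
  using fin T'
proof (induction "card (S - T')" arbitrary: T')
  case 0
  then show ?case by (intro exI[of _ "\<lambda>_. T'"]) auto
next
  case (Suc n)
  then have ne: "S - T' \<noteq> {}" by force
  define m where "m = Max (h ` (S - T'))"
  have "m \<in> h ` (S - T')" unfolding m_def using ne Suc.prems(1) by (intro Max_in) auto
  then obtain \<mu> where \<mu>: "\<mu> \<in> S" "\<mu> \<notin> T'" "h \<mu> = m" by auto
  have max: "h \<nu> \<le> h \<mu>" if "\<nu> \<in> S - T'" for \<nu>
    using that Suc.prems(1) by (simp add: \<mu>(3) m_def)
  have eq: "S - T' = insert \<mu> (S - insert \<mu> T')" using \<mu> by auto
  then have card: "n = card (S - insert \<mu> T')"
    using Suc.hyps(2) Suc.prems(1) by (metis Diff_iff card_insert_disjoint diff_Suc_1 insertI1 finite_insert)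
  have "\<exists>U. (\<forall>i \<le> card (S - insert \<mu> T'). T \<subseteq> U i \<and> U i \<subseteq> S \<and> (\<forall>x\<in>U i. \<forall>y\<in>S. x + y \<in> U i)) \<and>
     (\<forall>i < card (S - insert \<mu> T'). U i \<subset> U (Suc i)) \<and> U 0 = insert \<mu> T'"
  proof (rule Suc.hyps(1)[OF card])
    show "finite (S - insert \<mu> T')" using Suc.prems(1) by (rule rev_finite_subset) auto
    fix x y assume xy: "x \<in> insert \<mu> T'" "y \<in> S"
    show "x + y \<in> insert \<mu> T'"
    proof (cases "x = \<mu> \<and> y \<noteq> 0")
      case True
      \<comment> \<open>The sum exceeds the maximal height in \<open>S - T'\<close>, so it already
        lies in \<open>T'\<close>.\<close>
      then have "h (x + y) > h \<mu>" using h xy \<mu> by auto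
      moreover have "x + y \<in> S" using add_mem xy True \<mu> by auto
      ultimately show ?thesis using max[of "x + y"] by force
    qed (use xy Suc.prems(4) in auto)
  qed (use Suc.prems \<mu> in auto)
  then obtain U where U: "\<forall>i\<le>n. T \<subseteq> U i \<and> U i \<subseteq> S \<and> (\<forall>x\<in>U i. \<forall>y\<in>S. x + y \<in> U i)"
     "\<forall>i<n. U i \<subset> U (Suc i)" "U 0 = insert \<mu> T'"
    unfolding card[symmetric] by blast
  have "(\<forall>i\<le>Suc n. T \<subseteq> case_nat T' U i \<and> case_nat T' U i \<subseteq> S \<and> (\<forall>x\<in>case_nat T' U i. \<forall>y\<in>S. x + y \<in> case_nat T' U i))"
    using U(1) Suc.prems by (auto split: nat.splits)
  moreover have "\<forall>i<Suc n. case_nat T' U i \<subset> case_nat T' U (Suc i)"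
    using U(2,3) \<mu> by (auto split: nat.splits)
  ultimately show ?case unfolding Suc.hyps(2)[symmetric] by (intro exI[of _ "case_nat T' U"]) simp
qed

text \<open>A dimension count over \<open>K\<close>: each strict step contributes a vector outside
  the previous subspace, and all these vectors can be chosen in the span of the monomials with
  exponent in \<open>S - T\<close>.\<close>

lemma chain_bound:
  assumes fin: "finite (S - T)"
    and N: "\<And>i. i \<le> k \<Longrightarrow> submodule (N i) R Q" "\<And>i. i < k \<Longrightarrow> N i \<subset> N (Suc i)"
  shows "k \<le> card (S - T)"
proof -
  interpret vs: vector_space "\<lambda>c (f :: int ^ 'n \<Rightarrow>\<^sub>0 'k). Poly_Mapping.single 0 c * f"
    by (rule vector_space_scale)
  define P where "P i = {f \<in> M. J +>\<^bsub>R\<^esub> f \<in> N i}" for i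
  have sub: "subgroup (N i) (add_monoid Q)" if "i \<le> k" for i
    using N(1)[OF that] by (rule submodule.axioms(1))
  have Nsub: "N i \<subseteq> (\<lambda>f. J +>\<^bsub>R\<^esub> f) ` M" if "i \<le> k" for i
    using subgroup.subset[OF sub[OF that]] by simp
  have P_add: "f + g \<in> P i" if "i \<le> k" "f \<in> P i" "g \<in> P i" for f g i
    using subgroup.m_closed[OF sub[OF that(1)], of "J +>\<^bsub>R\<^esub> f" "J +>\<^bsub>R\<^esub> g"] that(2,3)
    by (simp add: P_def coset_add monomial_span_add)
  have P_mult: "r * f \<in> P i" if "i \<le> k" "f \<in> P i" "r \<in> M" for f r i
    using submodule.smult_closed[OF N(1)[OF that(1)], of r "J +>\<^bsub>R\<^esub> f"] that(2,3)
    by (simp add: P_def coset_mult span_mult)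
  have J_P: "J \<subseteq> P i" if "i \<le> k" for i
  proof
    fix f assume f: "f \<in> J"
    then have fM: "f \<in> M" using T(1) by (auto simp: monomial_span_def)
    have "J +>\<^bsub>R\<^esub> f = J" using coset_eq_iff[OF fM monomial_span_zero] f coset_zero by simp
    then show "f \<in> P i" using subgroup.one_closed[OF sub[OF that]] fM by (simp add: P_def)
  qed
  have subspace: "vs.subspace (P i)" if "i \<le> k" for i
    using that J_P[OF that] P_add P_mult const_mem monomial_span_zero
    by (intro vs.subspaceI) blast+
  have P_mono: "P i \<subseteq> P (Suc i)" if "i < k" for i
    using N(2)[OF that] by (auto simp: P_def)
  have "\<exists>f. f \<in> P (Suc i) - P i \<and> Poly_Mapping.keys f \<subseteq> S - T" if i: "i < k" for i
  proof -
    obtain A where A: "A \<in> N (Suc i)" "A \<notin> N i" using N(2)[OF i] by blast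
    then obtain g where g: "g \<in> M" "A = J +>\<^bsub>R\<^esub> g" using Nsub[of "Suc i"] i by auto
    \<comment> \<open>Terms with exponent in \<open>T\<close> lie in \<open>J\<close>; dropping them
      does not change the coset.\<close>
    define f where "f = (\<Sum>b\<in>Poly_Mapping.keys g - T. Poly_Mapping.single b (Poly_Mapping.lookup g b))"
    define j where "j = (\<Sum>b\<in>Poly_Mapping.keys g \<inter> T. Poly_Mapping.single b (Poly_Mapping.lookup g b))"
    have gfj: "g = f + j"
      unfolding f_def j_def by (subst poly_mapping_sum_single, subst sum.Int_Diff[of _ _ T]) (auto simp: add.commute)
    have j: "j \<in> J" unfolding j_def by (intro monomial_span_sum monomial_span_single) auto
    have "f \<in> monomial_span (S - T)" unfolding f_def
      using g(1) by (intro monomial_span_sum monomial_span_single) (auto simp: monomial_span_def)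
    then have f: "Poly_Mapping.keys f \<subseteq> S - T" "f \<in> M" by (auto simp: monomial_span_def)
    have "A = J +>\<^bsub>R\<^esub> f" using coset_eq_iff[OF g(1) f(2)] g(2) gfj j by simp
    then show ?thesis using A f by (auto simp: P_def)
  qed
  then obtain f where f: "\<And>i. i < k \<Longrightarrow> f i \<in> P (Suc i)" "\<And>i. i < k \<Longrightarrow> f i \<notin> P i"
     "\<And>i. i < k \<Longrightarrow> Poly_Mapping.keys (f i) \<subseteq> S - T"
    by (metis Diff_iff)
  have ind: "j \<le> k \<Longrightarrow> vs.independent (f ` {..<j}) \<and> f ` {..<j} \<subseteq> P j \<and> card (f ` {..<j}) = j" for j
  proof (induction j)
    case (Suc j)
    then have IH: "vs.independent (f ` {..<j})" "f ` {..<j} \<subseteq> P j" "card (f ` {..<j}) = j" by auto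
    have "vs.span (f ` {..<j}) \<subseteq> P j"
      using vs.span_minimal[OF IH(2) subspace] Suc.prems by simp
    then have "f j \<notin> vs.span (f ` {..<j})" "f j \<notin> f ` {..<j}" using f(2)[of j] Suc.prems IH(2) by auto
    moreover have "f ` {..<Suc j} = insert (f j) (f ` {..<j})" by (simp add: lessThan_Suc)
    ultimately show ?case
      using IH f(1)[of j] P_mono[of j] Suc.prems by (auto simp: vs.independent_insert)
  qed (simp add: vs.independent_empty)
  define E where "E = (\<lambda>b. Poly_Mapping.single b (1::'k)) ` (S - T)"
  have "f ` {..<k} \<subseteq> vs.span E"
  proof
    fix g assume "g \<in> f ` {..<k}"
    then have keys: "Poly_Mapping.keys g \<subseteq> S - T" using f(3) by auto
    have "g = (\<Sum>b\<in>Poly_Mapping.keys g. Poly_Mapping.single 0 (Poly_Mapping.lookup g b) * Poly_Mapping.single b 1)"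
      by (subst poly_mapping_sum_single) (simp add: mult_single)
    also have "\<dots> \<in> vs.span E"
      using keys by (intro vs.span_sum vs.span_scale vs.span_base) (auto simp: E_def)
    finally show "g \<in> vs.span E" .
  qed
  then have "card (f ` {..<k}) \<le> card E"
    using vs.independent_span_bound[of E "f ` {..<k}"] ind[of k] fin by (simp add: E_def)
  also have "\<dots> \<le> card (S - T)" unfolding E_def by (rule card_image_le[OF fin])
  finally show ?thesis using ind[of k] by simp
qed

lemma module_length_quotient:
  assumes fin: "finite (S - T)"
    and h: "\<And>x y. x \<in> S \<Longrightarrow> y \<in> S \<Longrightarrow> y \<noteq> 0 \<Longrightarrow> (h (x + y) :: int) > h x"
  shows "module_length R Q = enat (card (S - T))"
proof (rule antisym)
  show "module_length R Q \<le> enat (card (S - T))"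
    unfolding module_length_def
  proof (rule Sup_least)
    fix x assume "x \<in> {enat k |k. \<exists>N. (\<forall>i\<le>k. submodule (N i) R Q) \<and> (\<forall>i<k. N i \<subset> N (Suc i))}"
    then obtain k N where "x = enat k" "\<And>i. i \<le> k \<Longrightarrow> submodule (N i) R Q" "\<And>i. i < k \<Longrightarrow> N i \<subset> N (Suc i)"
      by blast
    then show "x \<le> enat (card (S - T))" using chain_bound[OF fin, of k N] by simp
  qed
  have "\<exists>U. (\<forall>i \<le> card (S - T). T \<subseteq> U i \<and> U i \<subseteq> S \<and> (\<forall>x\<in>U i. \<forall>y\<in>S. x + y \<in> U i)) \<and>
     (\<forall>i < card (S - T). U i \<subset> U (Suc i)) \<and> U 0 = T"
  proof (rule monoid_ideal_chain[where h = h])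
    show "x + y \<in> T" if "x \<in> T" "y \<in> S" for x y using T(2) that .
    show "h x < h (x + y)" if "x \<in> S" "y \<in> S" "y \<noteq> 0" for x y using h that .
  qed (use fin T(1) in auto)
  then obtain U where U':
      "\<forall>i \<le> card (S - T). T \<subseteq> U i \<and> U i \<subseteq> S \<and> (\<forall>x\<in>U i. \<forall>y\<in>S. x + y \<in> U i)"
      "\<forall>i < card (S - T). U i \<subset> U (Suc i)"
    by (elim exE conjE)
  have U: "T \<subseteq> U i" "U i \<subseteq> S" "\<And>x y. x \<in> U i \<Longrightarrow> y \<in> S \<Longrightarrow> x + y \<in> U i" if "i \<le> card (S - T)" for i
    using U'(1) that by auto
  have U_step: "U i \<subset> U (Suc i)" if "i < card (S - T)" for i
    using U'(2) that by auto
  have "(\<lambda>f. J +>\<^bsub>R\<^esub> f) ` monomial_span (U i) \<subset> (\<lambda>f. J +>\<^bsub>R\<^esub> f) ` monomial_span (U (Suc i))" 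
    if i: "i < card (S - T)" for i
  proof
    show "(\<lambda>f. J +>\<^bsub>R\<^esub> f) ` monomial_span (U i) \<subseteq> (\<lambda>f. J +>\<^bsub>R\<^esub> f) ` monomial_span (U (Suc i))"
      using U_step[OF i] by (intro image_mono) (auto simp: monomial_span_def)
    \<comment> \<open>The monomial of exponent \<open>\<mu>\<close> separates the two submodules:
      \<open>J\<close> lies in the span of \<open>U i\<close>, so an equality of cosets would put
      the monomial into that span.\<close>
    obtain \<mu> where \<mu>: "\<mu> \<in> U (Suc i)" "\<mu> \<notin> U i" using U_step[OF i] by blast
    define x where "x = Poly_Mapping.single \<mu> (1 :: 'k)"
    have "J +>\<^bsub>R\<^esub> x \<noteq> J +>\<^bsub>R\<^esub> f" if f: "f \<in> monomial_span (U i)" for f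
    proof
      assume *: "J +>\<^bsub>R\<^esub> x = J +>\<^bsub>R\<^esub> f"
      have "x \<in> M" using \<mu> U(2)[of "Suc i"] i unfolding x_def by (intro monomial_span_single) auto
      moreover have "f \<in> M" using f U(2)[of i] i by (auto simp: monomial_span_def)
      ultimately have "x - f \<in> J" using * coset_eq_iff by blast
      then have "x - f \<in> monomial_span (U i)" using U(1)[of i] i by (auto simp: monomial_span_def)
      from monomial_span_add[OF this f] have "x \<in> monomial_span (U i)" by simp
      then show False using \<mu> by (simp add: monomial_span_def x_def)
    qed
    moreover have "J +>\<^bsub>R\<^esub> x \<in> (\<lambda>f. J +>\<^bsub>R\<^esub> f) ` monomial_span (U (Suc i))"
      using \<mu>(1) by (auto simp: x_def intro: monomial_span_single)
    ultimately show "(\<lambda>f. J +>\<^bsub>R\<^esub> f) ` monomial_span (U i) \<noteq> (\<lambda>f. J +>\<^bsub>R\<^esub> f) ` monomial_span (U (Suc i))"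
      by blast
  qed
  moreover have "submodule ((\<lambda>f. J +>\<^bsub>R\<^esub> f) ` monomial_span (U i)) R Q" if "i \<le> card (S - T)" for i
    using U(2,3)[OF that] by (rule submodule_of_monoid_ideal)
  ultimately show "enat (card (S - T)) \<le> module_length R Q"
    unfolding module_length_def
    by (intro Sup_upper CollectI exI[of _ "card (S - T)"] conjI refl 
        exI[of _ "\<lambda>i. (\<lambda>f. J +>\<^bsub>R\<^esub> f) ` monomial_span (U i)"]) auto
qed

end

end

context facet_cone
begin

lemma module_length_diff_power:
  assumes "n \<ge> 1" and fin: "finite {\<mu> \<in> S. ht \<mu> < int n}"
  shows "module_length R (quotient_module R
      (diff_power (ring_of_type_algebra :: 'k ring) R (homogeneous_max_ideal C) n))
    = enat (card {\<mu> \<in> S. ht \<mu> < int n})"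
proof -
  have eq: "S - {\<mu> \<in> S. ht \<mu> \<ge> int n} = {\<mu> \<in> S. ht \<mu> < int n}" by auto
  have "module_length R (quotient_module R (monomial_span {\<mu> \<in> S. ht \<mu> \<ge> int n})) =
      enat (card (S - {\<mu> \<in> S. ht \<mu> \<ge> int n}))"
  proof (rule module_length_quotient)
    fix x y assume "x \<in> {\<mu> \<in> S. ht \<mu> \<ge> int n}" "y \<in> S"
    then show "x + y \<in> {\<mu> \<in> S. ht \<mu> \<ge> int n}" using ht_nonneg[of y] by (simp add: ht_add add_mem)
  next
    fix x y assume "x \<in> S" "y \<in> S" "y \<noteq> 0"
    then show "ht (x + y) > ht x" using ht_pos[of y] by (simp add: ht_add)
  qed (use fin in \<open>auto simp: eq\<close>)
  then show ?thesis by (simp add: diff_power_eq[OF assms(1)] eq)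
qed

end

section \<open>Facets of rational cones\<close>

text \<open>
  Applied to the coordinates of a real normal vector of a hyperplane spanned by lattice points,
  \<open>\<phi>\<close> produces a rational normal vector.
\<close>

lemma rational_linear_functional:
  fixes r :: real
  assumes "r \<noteq> 0"
  obtains \<phi> :: "real \<Rightarrow> rat" where "\<phi> r = 1" "\<And>x y. \<phi> (x + y) = \<phi> x + \<phi> y"
    "\<And>q x. \<phi> (of_rat q * x) = q * \<phi> x"
proof -
  interpret vector_space_pair "\<lambda>(q::rat) (x::real). of_rat q * x" "(*) :: rat \<Rightarrow> rat \<Rightarrow> rat"
    by unfold_locales (auto simp: algebra_simps of_rat_add of_rat_mult)
  have "vs1.independent {r}" using assms by (simp add: vs1.independent_insert vs1.independent_empty)
  then obtain \<phi> where \<phi>: "Vector_Spaces.linear (\<lambda>(q::rat) (x::real). of_rat q * x) ((*) :: rat \<Rightarrow> rat \<Rightarrow> rat) \<phi>" "\<phi> r = 1"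
    using linear_independent_extend[of "{r}" "\<lambda>_. 1"] by auto
  interpret \<phi>: Vector_Spaces.linear "\<lambda>(q::rat) (x::real). of_rat q * x" "(*) :: rat \<Rightarrow> rat \<Rightarrow> rat" \<phi>
    by (rule \<phi>(1))
  show ?thesis using that[of \<phi>] \<phi>(2) \<phi>.add \<phi>.scale by blast
qed

lemma rat_common_denominator:
  fixes q :: "'i \<Rightarrow> rat"
  assumes "finite A"
  shows "\<exists>N :: int. N > 0 \<and> (\<forall>i\<in>A. of_int N * q i \<in> \<int>)"
  using assms
proof (induction A rule: finite_induct)
  case empty
  show ?case by (intro exI[of _ 1]) auto
next
  case (insert i A)
  then obtain N where N: "N > 0" "\<forall>i\<in>A. of_int N * q i \<in> \<int>" by auto
  obtain u v where uv: "q i = of_int u / of_int v" "v > 0"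
    by (cases "q i") (auto simp: Fract_of_int_quotient)
  show ?case
  proof (intro exI[of _ "N * v"] conjI ballI)
    fix j assume j: "j \<in> insert i A"
    show "of_int (N * v) * q j \<in> \<int>"
    proof (cases "j = i")
      case True
      have "of_int (N * v) * q i = of_int (N * u)" using uv by simp
      then show ?thesis unfolding True by (metis Ints_of_int)
    next
      case False
      then have "of_int N * q j \<in> \<int>" using N(2) j by simp
      then have "of_int v * (of_int N * q j) \<in> \<int>" by (rule Ints_mult[OF Ints_of_int])
      then show ?thesis by (simp add: mult_ac)
    qed
  qed (use N uv in auto)
qed

lemma bezout_Gcd_int:
  fixes b :: "'i \<Rightarrow> int"
  assumes "finite A"
  shows "\<exists>e. (\<Sum>i\<in>A. b i * e i) = Gcd (b ` A)"
  using assms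
proof (induction A rule: finite_induct)
  case (insert i A)
  then obtain e where e: "(\<Sum>i\<in>A. b i * e i) = Gcd (b ` A)" by auto
  obtain u v where uv: "u * b i + v * Gcd (b ` A) = gcd (b i) (Gcd (b ` A))" using bezout_int by blast
  have "(\<Sum>j\<in>insert i A. b j * (if j = i then u else v * e j)) = b i * u + (\<Sum>j\<in>A. b j * (v * e j))"
    using insert.hyps by (auto intro!: sum.cong)
  also have "(\<Sum>j\<in>A. b j * (v * e j)) = v * Gcd (b ` A)"
    by (simp add: e[symmetric] sum_distrib_left mult_ac)
  also have "b i * u + v * Gcd (b ` A) = Gcd (b ` insert i A)"
    using uv by (simp add: mult_ac)
  finally show ?case by (rule exI[of _ "\<lambda>j. if j = i then u else v * e j"])
qed simp

definition primitive_vec :: "int ^ 'n \<Rightarrow> bool" where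
  "primitive_vec b \<longleftrightarrow> Gcd (range (\<lambda>i. b $ i)) = 1"

lemma primitive_vec_bezout: "primitive_vec b \<Longrightarrow> \<exists>e. (\<Sum>i\<in>UNIV. b $ i * e $ i) = 1"
proof -
  assume "primitive_vec b"
  then obtain e where "(\<Sum>i\<in>UNIV. b $ i * e i) = 1"
    using bezout_Gcd_int[OF finite, of "vec_nth b" UNIV] by (auto simp: primitive_vec_def)
  then show ?thesis by (intro exI[of _ "vec_lambda e"]) simp
qed

lemma inner_real_vec: "real_vec a \<bullet> P = (\<Sum>i\<in>UNIV. real_of_int (a $ i) * P $ i)"
  by (simp add: inner_vec_def real_vec_def)

lemma inner_real_vec_real_vec: "real_vec a \<bullet> real_vec b = real_of_int (\<Sum>i\<in>UNIV. a $ i * b $ i)"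
  by (simp add: inner_vec_def real_vec_def)

lemma real_vec_add: "real_vec (x + y) = real_vec x + real_vec y"
  by (simp add: real_vec_def vec_eq_iff)

lemma real_vec_0: "real_vec 0 = 0"
  by (simp add: real_vec_def vec_eq_iff)

lemma real_vec_sum: "real_vec (sum f A) = (\<Sum>i\<in>A. real_vec (f i))"
  by (induction A rule: infinite_finite_induct) (simp_all add: real_vec_add real_vec_0)

text \<open>Pairing with Bezout vectors of \<open>b\<close> and \<open>b'\<close> shows that
  \<open>c\<close> and its inverse are integers; being positive, \<open>c\<close> is
  \<open>1\<close>.\<close>

lemma primitive_vec_parallel_unique:
  assumes b: "primitive_vec b" and b': "primitive_vec b'"
    and eq: "real_vec b' = c *\<^sub>R real_vec b" and c: "c > 0"
  shows "b' = b"
proof -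
  obtain e where e: "(\<Sum>i\<in>UNIV. b $ i * e $ i) = 1" using primitive_vec_bezout[OF b] by blast
  obtain e' where e': "(\<Sum>i\<in>UNIV. b' $ i * e' $ i) = 1" using primitive_vec_bezout[OF b'] by blast
  define m where "m = (\<Sum>i\<in>UNIV. b' $ i * e $ i)"
  define m' where "m' = (\<Sum>i\<in>UNIV. b $ i * e' $ i)"
  have "real_of_int m = real_vec b' \<bullet> real_vec e" by (simp only: inner_real_vec_real_vec m_def)
  also have "\<dots> = c * (real_vec b \<bullet> real_vec e)" by (simp add: eq)
  finally have m: "real_of_int m = c" by (simp add: inner_real_vec_real_vec e del: of_int_sum of_int_mult)
  have "1 = real_vec b' \<bullet> real_vec e'" by (simp add: inner_real_vec_real_vec e' del: of_int_sum of_int_mult)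
  also have "\<dots> = c * real_of_int m'" by (simp only: eq inner_scaleR_left inner_real_vec_real_vec m'_def)
  finally have "m * m' = 1" using m by (metis of_int_1 of_int_eq_iff of_int_mult)
  moreover have "m > 0" using m c by simp
  ultimately have "m = 1" using zmult_eq_1_iff[of m m'] by auto
  then have "real_vec b' = real_vec b" using m eq by simp
  then show ?thesis by (simp add: real_vec_def vec_eq_iff)
qed

text \<open>The orthogonality conditions have integer coefficients, so applying a rational-linear
  \<open>\<phi>\<close> to the coordinates of \<open>a\<close> gives a rational solution, nonzero
  because \<open>\<phi>\<close> is \<open>1\<close> at one coordinate. Clearing denominators and
  dividing by the gcd makes it primitive, and \<open>uniq\<close> makes it parallel to
  \<open>a\<close>.\<close>

lemma integral_normal:
  fixes a :: "real ^ 'n"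
  assumes "a \<noteq> 0" and orth: "\<And>v. v \<in> W \<Longrightarrow> a \<bullet> real_vec v = 0"
    and uniq: "\<And>x. (\<And>v. v \<in> W \<Longrightarrow> x \<bullet> real_vec v = 0) \<Longrightarrow> \<exists>c. x = c *\<^sub>R a"
  obtains b c where "primitive_vec b" "c > 0" "real_vec b = c *\<^sub>R a"
proof -
  obtain k where k: "a $ k \<noteq> 0" using assms(1) by (auto simp: vec_eq_iff)
  obtain \<phi> :: "real \<Rightarrow> rat" where \<phi>: "\<phi> (a $ k) = 1" "\<And>x y. \<phi> (x + y) = \<phi> x + \<phi> y"
    "\<And>q x. \<phi> (of_rat q * x) = q * \<phi> x"
    using rational_linear_functional[OF k] by blast
  have \<phi>0: "\<phi> 0 = 0" using \<phi>(2)[of 0 0] by simp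
  have \<phi>_sum: "\<phi> (sum f A) = (\<Sum>i\<in>A. \<phi> (f i))" for f :: "'n \<Rightarrow> real" and A
    by (induction A rule: infinite_finite_induct) (auto simp: \<phi>0 \<phi>(2))
  have \<phi>_orth: "(\<Sum>i\<in>UNIV. \<phi> (a $ i) * of_int (v $ i)) = 0" if "v \<in> W" for v
  proof -
    have "0 = \<phi> (\<Sum>i\<in>UNIV. of_rat (of_int (v $ i)) * a $ i)"
      using orth[OF that] \<phi>0 by (simp add: inner_vec_def real_vec_def mult.commute)
    also have "\<dots> = (\<Sum>i\<in>UNIV. of_int (v $ i) * \<phi> (a $ i))"
      unfolding \<phi>_sum \<phi>(3) ..
    finally show ?thesis by (simp add: mult.commute)
  qed
  obtain N where N: "N > 0" "\<And>i. of_int N * \<phi> (a $ i) \<in> \<int>"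
    using rat_common_denominator[of "UNIV :: 'n set" "\<lambda>i. \<phi> (a $ i)"] by auto
  have "\<forall>i. \<exists>m. of_int N * \<phi> (a $ i) = of_int m" using N(2) by (meson Ints_cases)
  then obtain m where m: "\<And>i. of_int N * \<phi> (a $ i) = of_int (m i)" by metis
  define g where "g = Gcd (range m)"
  have "of_int (m k) = (of_int N :: rat)" using m[of k] \<phi>(1) by simp
  then have "m k = N" by simp
  then have "g \<noteq> 0" using N(1) unfolding g_def by (metis Gcd_0_iff UNIV_I image_subset_iff less_irrefl singletonD)
  moreover have "g \<ge> 0" by (simp add: g_def)
  ultimately have g: "g > 0" by simp
  have gdvd: "g dvd m i" for i by (simp add: g_def)
  \<comment> \<open>\<open>\<sigma>\<close> is a sign, fixed at the end, because \<open>uniq\<close>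
    does not control the sign of the factor.\<close>
  define s where "s \<sigma> = (\<chi> i. \<sigma> * (m i div g))" for \<sigma> :: int
  have prim: "primitive_vec (s \<sigma>)" if \<sigma>: "\<bar>\<sigma>\<bar> = 1" for \<sigma>
  proof -
    define h where "h = Gcd (range (\<lambda>i. s \<sigma> $ i))"
    have "h * g dvd m i" for i
    proof -
      have "h dvd \<sigma> * (m i div g)" unfolding h_def s_def by (intro Gcd_dvd) auto
      then have "h dvd m i div g" using \<sigma> by (auto simp: abs_if split: if_splits)
      then show ?thesis using gdvd[of i] by (metis dvd_div_mult_self dvd_refl mult_dvd_mono)
    qed
    then have "h * g dvd g" unfolding g_def by (intro Gcd_greatest) auto
    then have "h dvd 1" using g by simp
    moreover have "h \<ge> 0" by (simp add: h_def)
    ultimately show ?thesis by (simp add: primitive_vec_def h_def)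
  qed
  have "real_vec (s 1) \<bullet> real_vec v = 0" if v: "v \<in> W" for v
  proof -
    have "of_int (g * (\<Sum>i\<in>UNIV. (m i div g) * v $ i)) = (\<Sum>i\<in>UNIV. of_int (m i) * of_int (v $ i) :: rat)"
      using gdvd by (auto simp: sum_distrib_left mult.assoc[symmetric] simp flip: of_int_mult of_int_sum)
    also have "\<dots> = of_int N * (\<Sum>i\<in>UNIV. \<phi> (a $ i) * of_int (v $ i))"
      by (simp add: m[symmetric] sum_distrib_left mult.assoc)
    also have "\<dots> = 0" using \<phi>_orth[OF v] by simp
    finally have "(\<Sum>i\<in>UNIV. (m i div g) * v $ i) = 0"
      using g by (simp del: of_int_mult of_int_sum)
    then show ?thesis unfolding inner_real_vec_real_vec s_def by simp
  qed
  then obtain c where c: "real_vec (s 1) = c *\<^sub>R a" using uniq by blast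
  have "real_vec (s 1) $ k \<noteq> 0"
    using \<open>m k = N\<close> gdvd[of k] N(1) by (auto simp: real_vec_def s_def dvd_div_eq_0_iff)
  then have "c \<noteq> 0" using c by auto
  have neg: "real_vec (s (-1)) = - real_vec (s 1)" by (simp add: s_def real_vec_def vec_eq_iff)
  show ?thesis
  proof (cases "c > 0")
    case True then show ?thesis using that[of "s 1" c] prim[of 1] c by simp
  next
    case False then show ?thesis using that[of "s (-1)" "- c"] prim[of "-1"] c neg \<open>c \<noteq> 0\<close> by simp
  qed
qed

section \<open>Normals and forms of facets\<close>

text \<open>A facet of a full-dimensional \<open>C\<close> has codimension one, so its affine hull
  is the whole hyperplane orthogonal to \<open>a\<close>, and \<open>x\<close> is orthogonal to all
  of it.\<close>

lemma facet_normal_unique: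
  fixes C :: "(real ^ 'n) set"
  assumes F: "F facet_of C" and dim: "aff_dim C = int CARD('n)"
    and a: "a \<noteq> 0" "F \<subseteq> {y. a \<bullet> y = 0}" and x: "F \<subseteq> {y. x \<bullet> y = 0}"
  shows "\<exists>c. x = c *\<^sub>R a"
proof -
  have "affine hull F = {y. a \<bullet> y = 0}"
  proof (rule affine_dim_equal)
    show "affine hull F \<subseteq> {y. a \<bullet> y = 0}" using a(2) by (intro hull_minimal affine_hyperplane)
    show "affine hull F \<noteq> {}" using F by (simp add: facet_of_def)
    show "aff_dim (affine hull F) = aff_dim {y. a \<bullet> y = 0}"
      using F a(1) dim by (simp add: facet_of_def aff_dim_hyperplane)
  qed (auto simp: affine_hyperplane)
  moreover have "affine hull F \<subseteq> {y. x \<bullet> y = 0}" using x by (intro hull_minimal affine_hyperplane)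
  ultimately have *: "x \<bullet> y = 0" if "a \<bullet> y = 0" for y using that by auto
  \<comment> \<open>\<open>y\<close> is the part of \<open>x\<close> orthogonal to \<open>a\<close>;
    it is therefore orthogonal to \<open>x\<close>, and so to itself.\<close>
  define y where "y = x - ((x \<bullet> a) / (a \<bullet> a)) *\<^sub>R a"
  have ay: "a \<bullet> y = 0" using a(1) by (simp add: y_def inner_diff_right inner_commute)
  then have "y \<bullet> y = 0" using *[OF ay] by (simp add: y_def inner_diff_left inner_commute)
  then show ?thesis by (auto simp: y_def)
qed

text \<open>The points where \<open>a\<close> is nonnegative and the claim holds form a convex cone
  containing \<open>V\<close>, since a sum of nonnegative values is zero only if each is. Thus a
  facet of a rational cone lies in the span of the lattice vectors on it.\<close>

lemma convex_cone_hull_supporting: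
  fixes a y :: "'a::euclidean_space"
  assumes "y \<in> convex_cone hull V" "a \<bullet> y = 0" "\<And>v. v \<in> V \<Longrightarrow> a \<bullet> v \<ge> 0"
  shows "y \<in> span {v \<in> V. a \<bullet> v = 0}"
proof -
  let ?W = "{v \<in> V. a \<bullet> v = 0}"
  have "convex_cone {y. a \<bullet> y \<ge> 0 \<and> (a \<bullet> y = 0 \<longrightarrow> y \<in> span ?W)}"
    unfolding convex_cone_iff
    by (auto simp: inner_add_right span_add span_scale span_zero add_nonneg_eq_0_iff)
  then have "convex_cone hull V \<subseteq> {y. a \<bullet> y \<ge> 0 \<and> (a \<bullet> y = 0 \<longrightarrow> y \<in> span ?W)}"
    using assms(3) by (intro hull_minimal) (auto intro: span_base)
  then show ?thesis using assms by auto
qed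

lemma orthogonal_span:
  fixes x y :: "'a::euclidean_space"
  assumes "\<And>v. v \<in> W \<Longrightarrow> x \<bullet> v = 0" "y \<in> span W"
  shows "x \<bullet> y = 0"
proof -
  have "span W \<subseteq> {y. x \<bullet> y = 0}"
    using assms(1) by (intro span_minimal) (auto simp: subspace_hyperplane)
  then show ?thesis using assms(2) by auto
qed

lemma full_dim_interior_nonempty:
  fixes C :: "(real ^ 'n) set"
  assumes "convex C" "aff_dim C = int CARD('n)"
  shows "interior C \<noteq> {}"
  using interior_rel_interior_gen[of C] assms rel_interior_eq_empty[of C] by fastforce

lemma interior_pos:
  fixes b :: "real ^ 'n"
  assumes "b \<noteq> 0" "\<And>x. x \<in> C \<Longrightarrow> b \<bullet> x \<ge> 0" "P \<in> interior C"
  shows "b \<bullet> P > 0"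
proof -
  have "P \<in> interior {x. b \<bullet> x \<ge> 0}" using assms interior_mono[of C "{x. b \<bullet> x \<ge> 0}"] by auto
  then show ?thesis using assms(1) by (simp add: interior_halfspace_ge)
qed

lemma primitive_vec_nonzero: "primitive_vec b \<Longrightarrow> real_vec b \<noteq> 0"
proof
  assume "primitive_vec b" "real_vec b = 0"
  moreover from this have "(\<lambda>i. b $ i) = (\<lambda>i. 0)" by (simp add: real_vec_def vec_eq_iff)
  ultimately show False by (simp add: primitive_vec_def)
qed

text \<open>For uniqueness, the facet makes a second candidate proportional to \<open>b\<close>, the
  interior makes the factor positive, and coprimality makes it \<open>1\<close>.\<close>

lemma facet_form_eq:
  fixes C :: "(real ^ 'n) set"
  assumes F: "F facet_of C" and C: "convex C" "aff_dim C = int CARD('n)"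
    and b: "primitive_vec b" "\<And>x. x \<in> C \<Longrightarrow> real_vec b \<bullet> x \<ge> 0" "F \<subseteq> {y. real_vec b \<bullet> y = 0}"
  shows "facet_form C F = (\<lambda>P. real_vec b \<bullet> P)"
  unfolding facet_form_def
proof (rule the_equality)
  show "(\<exists>a :: int ^ 'n. Gcd (range (\<lambda>i. a $ i)) = 1 \<and>
        (\<lambda>P. real_vec b \<bullet> P) = (\<lambda>P. \<Sum>i\<in>UNIV. real_of_int (a $ i) * P $ i)) \<and>
     (\<forall>P\<in>F. real_vec b \<bullet> P = 0) \<and> (\<forall>P\<in>interior C. real_vec b \<bullet> P > 0)"
    using b interior_pos[OF primitive_vec_nonzero[OF b(1)] b(2)]
    by (auto simp: primitive_vec_def inner_real_vec[abs_def])
  fix l :: "real ^ 'n \<Rightarrow> real" assume l: "(\<exists>a :: int ^ 'n. Gcd (range (\<lambda>i. a $ i)) = 1 \<and>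
        l = (\<lambda>P. \<Sum>i\<in>UNIV. real_of_int (a $ i) * P $ i)) \<and>
     (\<forall>P\<in>F. l P = 0) \<and> (\<forall>P\<in>interior C. l P > 0)"
  then obtain a where a: "primitive_vec a" "l = (\<lambda>P. real_vec a \<bullet> P)"
    by (auto simp: primitive_vec_def inner_real_vec[abs_def])
  obtain c where c: "real_vec a = c *\<^sub>R real_vec b"
    using facet_normal_unique[OF F C(2) primitive_vec_nonzero[OF b(1)] b(3), of "real_vec a"] l a by auto
  obtain P where P: "P \<in> interior C" using full_dim_interior_nonempty[OF C] by blast
  have "0 < c * (real_vec b \<bullet> P)" using l a c P by auto
  moreover have "real_vec b \<bullet> P > 0" using interior_pos[OF primitive_vec_nonzero[OF b(1)] b(2) P] .
  ultimately have "c > 0" by (simp add: zero_less_mult_iff)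
  then show "l = (\<lambda>P. real_vec b \<bullet> P)"
    using primitive_vec_parallel_unique[OF b(1) a(1) c] a(2) by simp
qed

text \<open>Collects the geometry in the shape that \<open>facet_cone\<close> requires, with one
  primitive inward normal \<open>b F\<close> for each facet.\<close>

lemma cone_facet_data:
  fixes C :: "(real ^ 'n) set"
  assumes C: "pointed_rational_cone C" and dim: "aff_dim C = int CARD('n)"
  obtains b :: "(real ^ 'n) set \<Rightarrow> int ^ 'n" where
    "finite {F. F facet_of C}"
    "\<And>F. F facet_of C \<Longrightarrow> primitive_vec (b F)"
    "\<And>F. F facet_of C \<Longrightarrow> facet_form C F = (\<lambda>P. real_vec (b F) \<bullet> P)"
    "\<And>P. P \<in> C \<longleftrightarrow> (\<forall>F. F facet_of C \<longrightarrow> real_vec (b F) \<bullet> P \<ge> 0)"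
    "\<And>F. F facet_of C \<Longrightarrow> \<exists>u. real_vec (b F) \<bullet> real_vec u = 0 \<and>
       (\<forall>F'. F' facet_of C \<longrightarrow> F' \<noteq> F \<longrightarrow> real_vec (b F') \<bullet> real_vec u > 0)"
    "\<exists>w. \<forall>F. F facet_of C \<longrightarrow> real_vec (b F) \<bullet> real_vec w > 0"
    "\<And>P. (\<And>F. F facet_of C \<Longrightarrow> real_vec (b F) \<bullet> P = 0) \<Longrightarrow> P = 0"
proof -
  obtain V :: "(int ^ 'n) set" where V: "finite V" "C = convex_cone hull (real_vec ` V)"
    using C by (auto simp: pointed_rational_cone_def)
  have no_line: "\<not> {x + t *\<^sub>R v | t. True} \<subseteq> C" if "v \<noteq> 0" for x v
    using C that by (auto simp: pointed_rational_cone_def)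
  have cc: "convex_cone C" unfolding V by (rule convex_cone_convex_cone_hull)
  have conv: "convex C" using cc by (simp add: convex_cone_def)
  have VC: "real_vec v \<in> C" if "v \<in> V" for v unfolding V using that by (intro hull_inc) auto
  have poly: "polyhedron C" unfolding V using V(1) by (intro polyhedron_convex_cone_hull) auto
  have full: "affine hull C = UNIV" using dim by (simp add: aff_dim_eq_full flip: aff_dim_eq_full)
  \<comment> \<open>Minimality of the description is what makes every half-space in \<open>G\<close>
    cut out a facet.\<close>
  obtain G where G: "finite G" "C = affine hull C \<inter> \<Inter>G"
    "\<forall>h\<in>G. \<exists>a b. a \<noteq> 0 \<and> h = {x. a \<bullet> x \<le> b}"
    "\<And>F'. F' \<subset> G \<Longrightarrow> C \<subset> affine hull C \<inter> \<Inter>F'"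
    using poly unfolding polyhedron_Int_affine_minimal by blast
  obtain a \<beta> where a: "\<And>h. h \<in> G \<Longrightarrow> a h \<noteq> 0 \<and> h = {x. a h \<bullet> x \<le> \<beta> h}"
    using G(3) by metis
  have facet_iff: "F facet_of C \<longleftrightarrow> (\<exists>h. h \<in> G \<and> F = C \<inter> {x. a h \<bullet> x = \<beta> h})" for F
    by (rule facet_of_polyhedron_explicit[OF G(1,2) a G(4)])
  have C_iff: "x \<in> C \<longleftrightarrow> (\<forall>h\<in>G. a h \<bullet> x \<le> \<beta> h)" for x
    using G(2) a full by auto
  have \<beta>: "\<beta> h = 0" if h: "h \<in> G" for h
  proof -
    have "(C \<inter> {x. a h \<bullet> x = \<beta> h}) facet_of C" using facet_iff h by blast
    then obtain x where x: "x \<in> C" "a h \<bullet> x = \<beta> h" by (auto simp: facet_of_def)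
    \<comment> \<open>These two points give \<open>2 * \<beta> h \<le> \<beta> h\<close> and
      \<open>0 \<le> \<beta> h\<close>.\<close>
    have "2 *\<^sub>R x \<in> C" "0 \<in> C" using cc x(1) by (auto simp: convex_cone_iff)
    then have "a h \<bullet> (2 *\<^sub>R x) \<le> \<beta> h" "a h \<bullet> 0 \<le> \<beta> h" using C_iff h by blast+
    then show ?thesis using x(2) by simp
  qed
  define fac where "fac h = C \<inter> {x. a h \<bullet> x = 0}" for h
  have fac: "fac h facet_of C" if "h \<in> G" for h
    using facet_iff \<beta>[OF that] that by (auto simp: fac_def)
  have facet_iff': "F facet_of C \<longleftrightarrow> (\<exists>h\<in>G. F = fac h)" for F
    using facet_iff \<beta> by (auto simp: fac_def)
  have C_iff': "x \<in> C \<longleftrightarrow> (\<forall>h\<in>G. a h \<bullet> x \<le> 0)" for x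
    using C_iff \<beta> by auto
  have span: "C \<inter> {x. c \<bullet> x = 0} \<subseteq> span (real_vec ` {v \<in> V. c \<bullet> real_vec v = 0})"
    if "\<And>x. x \<in> C \<Longrightarrow> c \<bullet> x \<ge> 0" for c
  proof
    fix y assume "y \<in> C \<inter> {x. c \<bullet> x = 0}"
    then have "y \<in> span {v \<in> real_vec ` V. c \<bullet> v = 0}"
      using that VC unfolding V(2) by (intro convex_cone_hull_supporting) auto
    also have "{v \<in> real_vec ` V. c \<bullet> v = 0} = real_vec ` {v \<in> V. c \<bullet> real_vec v = 0}" by auto
    finally show "y \<in> span (real_vec ` {v \<in> V. c \<bullet> real_vec v = 0})" .
  qed
  \<comment> \<open>\<open>a h\<close> points outward, so the inward normal is \<open>- a h\<close>;
    the generators on the facet are the lattice vectors that determine it.\<close>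
  have "\<exists>b. primitive_vec b \<and> (\<exists>c>0. real_vec b = c *\<^sub>R (- a h))" if h: "h \<in> G" for h
  proof -
    let ?W = "{v \<in> V. (- a h) \<bullet> real_vec v = 0}"
    have sub: "fac h \<subseteq> span (real_vec ` ?W)"
      using span[of "- a h"] C_iff' h by (auto simp: fac_def)
    show ?thesis
    proof (rule integral_normal[of "- a h" ?W])
      show "- a h \<noteq> 0" using a[OF h] by simp
      show "(- a h) \<bullet> real_vec v = 0" if "v \<in> ?W" for v using that by simp
      show "\<exists>c. x = c *\<^sub>R (- a h)" if "\<And>v. v \<in> ?W \<Longrightarrow> x \<bullet> real_vec v = 0" for x
      proof (rule facet_normal_unique[OF fac[OF h] dim])
        show "fac h \<subseteq> {y. x \<bullet> y = 0}"
          using sub orthogonal_span[of "real_vec ` ?W" x] that by blast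
      qed (use a[OF h] in \<open>auto simp: fac_def\<close>)
    qed blast
  qed
  then obtain bh where bh: "\<And>h. h \<in> G \<Longrightarrow> primitive_vec (bh h)"
      "\<And>h. h \<in> G \<Longrightarrow> \<exists>c>0. real_vec (bh h) = c *\<^sub>R (- a h)"
    by metis
  have bh_nonneg: "real_vec (bh h) \<bullet> x \<ge> 0 \<longleftrightarrow> a h \<bullet> x \<le> 0" 
    and bh_zero: "real_vec (bh h) \<bullet> x = 0 \<longleftrightarrow> a h \<bullet> x = 0" if h: "h \<in> G" for h x
    using bh(2)[OF h] by (auto simp: mult_le_0_iff)
  have form: "facet_form C (fac h) = (\<lambda>P. real_vec (bh h) \<bullet> P)" if h: "h \<in> G" for h
    by (rule facet_form_eq[OF fac[OF h] conv dim bh(1)[OF h]])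
       (use C_iff' h in \<open>auto simp: bh_nonneg bh_zero fac_def\<close>)
  define b where "b F = bh (SOME h. h \<in> G \<and> F = fac h)" for F
  have b: "\<exists>h\<in>G. F = fac h \<and> b F = bh h" if F: "F facet_of C" for F
    using someI_ex[of "\<lambda>h. h \<in> G \<and> F = fac h"] F unfolding b_def facet_iff' by blast
  have b_prim: "primitive_vec (b F)" if "F facet_of C" for F using b[OF that] bh(1) by auto
  have b_form: "facet_form C F = (\<lambda>P. real_vec (b F) \<bullet> P)" if "F facet_of C" for F
    using b[OF that] form by auto
  have b_fac: "F = C \<inter> {x. real_vec (b F) \<bullet> x = 0}" if "F facet_of C" for F
    using b[OF that] bh_zero by (auto simp: fac_def)
  have b_iff: "P \<in> C \<longleftrightarrow> (\<forall>F. F facet_of C \<longrightarrow> real_vec (b F) \<bullet> P \<ge> 0)" for P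
  proof -
    have "(\<forall>F. F facet_of C \<longrightarrow> real_vec (b F) \<bullet> P \<ge> 0) \<longleftrightarrow> (\<forall>F. F facet_of C \<longrightarrow> facet_form C F P \<ge> 0)"
      using b_form by auto
    also have "\<dots> \<longleftrightarrow> (\<forall>h\<in>G. facet_form C (fac h) P \<ge> 0)" unfolding facet_iff' by blast
    also have "\<dots> \<longleftrightarrow> P \<in> C" unfolding C_iff' using form bh_nonneg by auto
    finally show ?thesis by simp
  qed
  have sum_pos: "real_vec (b F) \<bullet> real_vec (\<Sum>W) > 0"
    if F: "F facet_of C" and W: "W \<subseteq> V" "v \<in> W" "real_vec (b F) \<bullet> real_vec v \<noteq> 0" for F W v
  proof -
    have finW: "finite W" using W(1) V(1) finite_subset by blast
    have nonneg: "real_vec (b F) \<bullet> real_vec v \<ge> 0" if "v \<in> W" for v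
      using b_iff VC F W(1) that by blast
    have "0 < (\<Sum>v\<in>W. real_vec (b F) \<bullet> real_vec v)"
      using W(2,3) nonneg finW by (intro sum_pos2[of _ v]) (auto simp: less_le)
    then show ?thesis by (simp add: real_vec_sum inner_sum_right)
  qed
  obtain P where P: "P \<in> interior C" using full_dim_interior_nonempty[OF conv dim] by blast
  show ?thesis
  proof (rule that[of b])
    show "finite {F. F facet_of C}" by (rule finite_polyhedron_facets[OF poly])
  next
    fix F assume F: "F facet_of C"
    let ?W = "{v \<in> V. real_vec (b F) \<bullet> real_vec v = 0}"
    have span_F: "F \<subseteq> span (real_vec ` ?W)"
      using span[of "real_vec (b F)"] b_iff F b_fac[OF F] by blast
    \<comment> \<open>The sum of the generators on \<open>F\<close> works: if \<open>b F'\<close>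
      vanished there, it would vanish at each of them, all values being nonnegative, hence on
      \<open>F\<close>; then the normals are proportional and the facets equal.\<close>
    show "\<exists>u. real_vec (b F) \<bullet> real_vec u = 0 \<and>
       (\<forall>F'. F' facet_of C \<longrightarrow> F' \<noteq> F \<longrightarrow> real_vec (b F') \<bullet> real_vec u > 0)"
    proof (intro exI[of _ "\<Sum>?W"] conjI allI impI)
      show "real_vec (b F) \<bullet> real_vec (\<Sum>?W) = 0" by (simp add: real_vec_sum inner_sum_right)
      fix F' assume F': "F' facet_of C" "F' \<noteq> F"
      show "real_vec (b F') \<bullet> real_vec (\<Sum>?W) > 0"
      proof (rule ccontr)
        assume "\<not> ?thesis"
        then have "real_vec (b F') \<bullet> real_vec v = 0" if "v \<in> ?W" for v
          using sum_pos[OF F'(1), of ?W v] that by blast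
        then have "F \<subseteq> {y. real_vec (b F') \<bullet> y = 0}"
          using span_F orthogonal_span[of "real_vec ` ?W" "real_vec (b F')"] by blast
        moreover have "F \<subseteq> {y. real_vec (b F) \<bullet> y = 0}" using b_fac[OF F] by blast
        ultimately obtain c where c: "real_vec (b F') = c *\<^sub>R real_vec (b F)"
          using facet_normal_unique[OF F dim primitive_vec_nonzero[OF b_prim[OF F]]] by blast
        then have "c \<noteq> 0" using primitive_vec_nonzero[OF b_prim[OF F'(1)]] by auto
        then have "{x. real_vec (b F') \<bullet> x = 0} = {x. real_vec (b F) \<bullet> x = 0}" by (simp add: c)
        then show False using b_fac[OF F] b_fac[OF F'(1)] F'(2) by metis
      qed
    qed
  next
    \<comment> \<open>For the sum of all generators, a vanishing form would vanish on
      \<open>C\<close>, against its positivity on the interior.\<close>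
    show "\<exists>w. \<forall>F. F facet_of C \<longrightarrow> real_vec (b F) \<bullet> real_vec w > 0"
    proof (intro exI[of _ "\<Sum>V"] allI impI)
      fix F assume F: "F facet_of C"
      show "real_vec (b F) \<bullet> real_vec (\<Sum>V) > 0"
      proof (rule ccontr)
        assume "\<not> ?thesis"
        then have "real_vec (b F) \<bullet> real_vec v = 0" if "v \<in> V" for v
          using sum_pos[OF F, of V v] that by blast
        then have "C \<subseteq> {x. real_vec (b F) \<bullet> x = 0}" unfolding V(2)
          by (intro hull_minimal) (auto simp: convex_cone_iff inner_add_right)
        moreover have "real_vec (b F) \<bullet> P > 0"
          using interior_pos[OF primitive_vec_nonzero[OF b_prim[OF F]] _ P] b_iff F by blast
        ultimately show False using P interior_subset by fastforce
      qed
    qed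
  next
    fix Q assume Q: "\<And>F. F facet_of C \<Longrightarrow> real_vec (b F) \<bullet> Q = 0"
    then have "{0 + t *\<^sub>R Q | t. True} \<subseteq> C" using b_iff by auto
    then show "Q = 0" using no_line[of Q 0] by blast
  qed (use b_prim b_form b_iff in auto)
qed

section \<open>Counting lattice points\<close>

lemma finite_int_vec_box: "finite {z :: int ^ 'n. \<forall>i. z $ i \<in> A}" if "finite A"
proof (rule finite_subset)
  show "{z :: int ^ 'n. \<forall>i. z $ i \<in> A} \<subseteq> vec_lambda ` PiE UNIV (\<lambda>_. A)"
  proof
    fix z :: "int ^ 'n" assume "z \<in> {z. \<forall>i. z $ i \<in> A}"
    then show "z \<in> vec_lambda ` PiE UNIV (\<lambda>_. A)"
      by (intro image_eqI[of _ _ "vec_nth z"]) auto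
  qed
qed (use that in \<open>intro finite_imageI finite_PiE; simp\<close>)

definition lattice_floor :: "nat \<Rightarrow> real ^ 'n \<Rightarrow> int ^ 'n" where
  "lattice_floor n x = (\<chi> i. \<lfloor>real n * x $ i\<rfloor>)"

text \<open>
  The scaled lattice count is the integral of the indicator function of \<open>T\<close> evaluated at the point
  of the lattice \<open>(1/n)\<int>\<^sup>d\<close> below the argument.
\<close>

lemma lattice_floor_dist:
  assumes "n > 0"
  shows "dist ((1 / real n) *\<^sub>R real_vec (lattice_floor n (x :: real ^ 'n))) x \<le> real CARD('n) / real n"
proof -
  have "\<bar>((1 / real n) *\<^sub>R real_vec (lattice_floor n x) - x) $ i\<bar> \<le> 1 / real n" for i
  proof -
    have "\<bar>real_of_int \<lfloor>real n * x $ i\<rfloor> - real n * x $ i\<bar> \<le> 1" by linarith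
    then have "\<bar>real_of_int \<lfloor>real n * x $ i\<rfloor> - real n * x $ i\<bar> / real n \<le> 1 / real n"
      by (intro divide_right_mono) auto
    also have "\<bar>real_of_int \<lfloor>real n * x $ i\<rfloor> - real n * x $ i\<bar> / real n = 
        \<bar>(real_of_int \<lfloor>real n * x $ i\<rfloor> - real n * x $ i) / real n\<bar>" by simp
    also have "(real_of_int \<lfloor>real n * x $ i\<rfloor> - real n * x $ i) / real n = 
      ((1 / real n) *\<^sub>R real_vec (lattice_floor n x) - x) $ i"
      using assms by (simp add: real_vec_def lattice_floor_def field_simps)
    finally show ?thesis .
  qed
  then have "norm ((1 / real n) *\<^sub>R real_vec (lattice_floor n x) - x) \<le> (\<Sum>i\<in>(UNIV::'n set). 1 / real n)"
    by (intro order_trans[OF norm_le_l1_cart] sum_mono)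
  then show ?thesis by (simp add: dist_norm)
qed

text \<open>The fibre is a half-open cube of side \<open>1 / n\<close>, squeezed between the open
  and the closed box with the same corners.\<close>

lemma lattice_floor_fiber:
  assumes "n > 0"
  shows "{x :: real ^ 'n. lattice_floor n x = z} \<in> sets borel" (is "?H \<in> _")
    and "emeasure lborel {x :: real ^ 'n. lattice_floor n x = z} = ennreal (1 / real n ^ CARD('n))"
proof -
  define l u :: "real ^ 'n" where "l = (\<chi> i. real_of_int (z $ i) / real n)" and "u = (\<chi> i. (real_of_int (z $ i) + 1) / real n)"
  have H: "?H = {x. \<forall>i. l $ i \<le> x $ i \<and> x $ i < u $ i}"
    using assms by (auto simp: lattice_floor_def vec_eq_iff floor_eq_iff l_def u_def field_simps)
  show meas: "?H \<in> sets borel"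
  proof -
    have "?H = (\<Inter>i. {x. l $ i \<le> x $ i} \<inter> {x. x $ i < u $ i})" unfolding H by auto
    also have "\<dots> \<in> sets borel"
      by (intro sets.finite_INT sets.Int borel_closed borel_open closed_Collect_le open_Collect_less continuous_intros) auto
    finally show ?thesis .
  qed
  have lu: "l \<bullet> b \<le> u \<bullet> b" if "b \<in> Basis" for b
    using that assms by (auto simp: Basis_vec_def inner_axis l_def u_def divide_right_mono)
  have prod: "(\<Prod>b\<in>Basis. (u - l) \<bullet> b) = 1 / real n ^ CARD('n)"
  proof -
    have "(\<Prod>b\<in>Basis. (u - l) \<bullet> b) = (\<Prod>b\<in>(Basis::(real^'n) set). 1 / real n)"
      using assms by (intro prod.cong refl) (auto simp: Basis_vec_def inner_axis l_def u_def diff_divide_distrib[symmetric])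
    then show ?thesis by (simp add: power_one_over)
  qed
  show "emeasure lborel ?H = ennreal (1 / real n ^ CARD('n))"
  proof (rule antisym)
    have "?H \<subseteq> cbox l u" unfolding H by (auto simp: mem_box_cart less_imp_le)
    then have "emeasure lborel ?H \<le> emeasure lborel (cbox l u)" by (intro emeasure_mono) auto
    also have "\<dots> = ennreal (1 / real n ^ CARD('n))"
      unfolding prod[symmetric] by (rule emeasure_lborel_cbox[OF lu])
    finally show "emeasure lborel ?H \<le> ennreal (1 / real n ^ CARD('n))" .
    have "box l u \<subseteq> ?H" unfolding H by (auto simp: mem_box_cart less_imp_le)
    then have "emeasure lborel (box l u) \<le> emeasure lborel ?H" using meas by (intro emeasure_mono) auto
    then show "ennreal (1 / real n ^ CARD('n)) \<le> emeasure lborel ?H"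
      unfolding prod[symmetric] by (subst (asm) emeasure_lborel_box[OF lu])
  qed
qed

text \<open>Dominated convergence: convexity makes the frontier of \<open>T\<close> a null set, off
  the frontier membership in \<open>T\<close> is locally constant, and boundedness gives the
  dominating indicator.\<close>

lemma lattice_count_tendsto_measure:
  fixes T :: "(real ^ 'n) set"
  assumes bdd: "bounded T" and conv: "convex T" and borel: "T \<in> sets borel"
  shows "(\<lambda>n. real (card {z. (1 / real n) *\<^sub>R real_vec z \<in> T}) / real n ^ CARD('n))
           \<longlonglongrightarrow> measure lborel T"
    and "n > 0 \<Longrightarrow> finite {z. (1 / real n) *\<^sub>R real_vec z \<in> T}"
proof -
  obtain r where r: "T \<subseteq> cball 0 r" using bdd unfolding bounded_iff by (metis mem_cball_0 subsetI)
  define Z where "Z n = {z. (1 / real n) *\<^sub>R real_vec z \<in> T}" for n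
  have fin: "finite (Z n)" if n: "n > 0" for n
  proof (rule finite_subset[OF _ finite_int_vec_box])
    show "Z n \<subseteq> {z. \<forall>i. z $ i \<in> {-\<lceil>real n * r\<rceil>..\<lceil>real n * r\<rceil>}}"
    proof clarify
      fix z i assume "z \<in> Z n"
      then have "norm ((1 / real n) *\<^sub>R real_vec z) \<le> r" using r by (auto simp: Z_def)
      then have "\<bar>((1 / real n) *\<^sub>R real_vec z) $ i\<bar> \<le> r"
        using component_le_norm_cart order_trans by blast
      then have "\<bar>real_of_int (z $ i)\<bar> \<le> real n * r"
        using n by (simp add: real_vec_def field_simps)
      then show "z $ i \<in> {-\<lceil>real n * r\<rceil>..\<lceil>real n * r\<rceil>}" by simp linarith
    qed
  qed simp
  then show "n > 0 \<Longrightarrow> finite {z. (1 / real n) *\<^sub>R real_vec z \<in> T}" by (simp add: Z_def)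
  define H where "H n z = {x :: real ^ 'n. lattice_floor n x = z}" for n z
  define g where "g n x = (indicator T ((1 / real n) *\<^sub>R real_vec (lattice_floor n x)) :: real)" for n x
  have g_sum: "g n = (\<lambda>x. \<Sum>z\<in>Z n. indicator (H n z) x)" if "n > 0" for n
  proof
    fix x
    have "(\<Sum>z\<in>Z n. indicator (H n z) x) = (\<Sum>z\<in>Z n. if lattice_floor n x = z then 1 else (0::real))"
      by (intro sum.cong) (auto simp: H_def)
    also have "\<dots> = g n x" using fin[OF that] by (simp add: g_def Z_def)
    finally show "g n x = (\<Sum>z\<in>Z n. indicator (H n z) x)" by simp
  qed
  have H_int: "integrable lborel (indicator (H n z) :: _ \<Rightarrow> real)" 
    "integral\<^sup>L lborel (indicator (H n z) :: _ \<Rightarrow> real) = 1 / real n ^ CARD('n)" if "n > 0" for n z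
    using lattice_floor_fiber[OF that, of z] by (auto simp: H_def measure_def)
  have int_g: "integral\<^sup>L lborel (g n) = real (card (Z n)) / real n ^ CARD('n)" if "n > 0" for n
    unfolding g_sum[OF that] by (subst Bochner_Integration.integral_sum, rule H_int(1)[OF that], simp only: H_int(2)[OF that]) simp
  have meas_g: "g n \<in> borel_measurable lborel" if "n > 0" for n
    unfolding g_sum[OF that] using H_int(1)[OF that] by (intro borel_measurable_sum) auto
  have null: "frontier T \<in> null_sets lborel"
  proof -
    have "frontier T \<in> sets lborel" by (simp add: borel_closed)
    then show ?thesis
      using negligible_convex_frontier[OF conv] null_sets_completion_iff[of "frontier T" lborel]
      by (simp add: negligible_iff_null_sets)
  qed
  have "(\<lambda>n. integral\<^sup>L lborel (g (Suc n))) \<longlonglongrightarrow> integral\<^sup>L lborel (indicator T :: _ \<Rightarrow> real)"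
  \<comment> \<open>The grid point is within \<open>CARD('n) / Suc n\<close> of its argument, so the
    radius grows by at most \<open>CARD('n)\<close>. The index \<open>Suc n\<close> keeps the grid
    spacing meaningful.\<close>
  proof (rule integral_dominated_convergence[where w = "indicator (cball 0 (r + real CARD('n)))"])
    show "integrable lborel (indicator (cball (0 :: real ^ 'n) (r + real CARD('n))) :: _ \<Rightarrow> real)"
      using emeasure_bounded_finite[of "cball (0 :: real ^ 'n) (r + real CARD('n))"] by (intro integrable_real_indicator) auto
    show "AE x in lborel. (\<lambda>n. g (Suc n) x) \<longlonglongrightarrow> indicator T x"
      using AE_not_in[OF null]
    proof eventually_elim
      case (elim x)
      define y where "y n = (1 / real (Suc n)) *\<^sub>R real_vec (lattice_floor (Suc n) x)" for n
      have y: "y \<longlonglongrightarrow> x"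
      proof (rule metric_tendsto_imp_tendsto[where f = "\<lambda>n. real CARD('n) / real (Suc n)" and a = 0])
        show "(\<lambda>n. real CARD('n) / real (Suc n)) \<longlonglongrightarrow> 0"
          using LIMSEQ_Suc[OF lim_const_over_n[of "real CARD('n)"]] by simp
        show "\<forall>\<^sub>F n in sequentially. dist (y n) x \<le> dist (real CARD('n) / real (Suc n)) 0"
          using lattice_floor_dist[of "Suc n" x for n] by (simp add: y_def)
      qed
      have "\<forall>\<^sub>F n in sequentially. (y n \<in> T \<longleftrightarrow> x \<in> T)"
      proof (cases "x \<in> T")
        case True
        then have "x \<in> interior T" using elim closure_subset by (auto simp: frontier_def)
        then have "\<forall>\<^sub>F n in sequentially. y n \<in> interior T"
          using y by (intro topological_tendstoD) auto
        then show ?thesis by eventually_elim (use True interior_subset in auto)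
      next
        case False
        then have "x \<in> - closure T" using elim interior_subset by (auto simp: frontier_def)
        then have "\<forall>\<^sub>F n in sequentially. y n \<in> - closure T"
          using y by (intro topological_tendstoD) auto
        then show ?thesis by eventually_elim (use False closure_subset in auto)
      qed
      then have "\<forall>\<^sub>F n in sequentially. g (Suc n) x = indicator T x"
        by eventually_elim (auto simp: g_def y_def indicator_def)
      then show ?case by (rule tendsto_eventually)
    qed
    show "AE x in lborel. norm (g (Suc n) x) \<le> indicator (cball 0 (r + real CARD('n))) x" for n
    proof (intro AE_I2)
      fix x :: "real ^ 'n"
      let ?y = "(1 / real (Suc n)) *\<^sub>R real_vec (lattice_floor (Suc n) x)"
      have "norm x \<le> r + real CARD('n)" if "?y \<in> T"
      proof -
        have "norm x \<le> norm ?y + dist ?y x"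
          by (metis dist_norm norm_minus_commute norm_triangle_sub)
        also have "dist ?y x \<le> real CARD('n) / real (Suc n)" by (rule lattice_floor_dist) simp
        also have "\<dots> \<le> real CARD('n)" by (simp add: divide_le_eq)
        also have "norm ?y \<le> r" using r that by auto
        finally show ?thesis by simp
      qed
      then show "norm (g (Suc n) x) \<le> indicator (cball 0 (r + real CARD('n))) x"
        by (auto simp: g_def indicator_def)
    qed
  qed (use borel meas_g in auto)
  then have "(\<lambda>n. real (card (Z (Suc n))) / real (Suc n) ^ CARD('n)) \<longlonglongrightarrow> measure lborel T"
    using borel by (simp add: int_g)
  then show "(\<lambda>n. real (card {z. (1 / real n) *\<^sub>R real_vec z \<in> T}) / real n ^ CARD('n))
           \<longlonglongrightarrow> measure lborel T"
    unfolding Z_def by (rule LIMSEQ_imp_Suc)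
qed

section \<open>The differential signature\<close>

text \<open>Here \<open>n\<close> is a vector. By compactness its form has a positive minimum on the
  unit vectors of \<open>C\<close>, if there are any, and homogeneity turns this into a bound on the
  norm.\<close>

lemma bounded_cone_slice:
  fixes C :: "'a::euclidean_space set"
  assumes "closed C" "conic C" and pos: "\<And>P. P \<in> C \<Longrightarrow> P \<noteq> 0 \<Longrightarrow> n \<bullet> P > 0"
  shows "bounded {P \<in> C. n \<bullet> P \<le> t}"
proof (cases "C \<inter> sphere 0 1 = {}")
  case True
  have "P = 0" if "P \<in> C" for P
  proof (rule ccontr)
    assume "P \<noteq> 0"
    then have "(1 / norm P) *\<^sub>R P \<in> C \<inter> sphere 0 1"
      using that assms(2) by (auto simp: conic_def)
    then show False using True by blast
  qed
  then have "{P \<in> C. n \<bullet> P \<le> t} \<subseteq> {0}" by blast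
  then show ?thesis by (rule bounded_subset[rotated]) simp
next
  case False
  have "compact (C \<inter> sphere 0 1)" by (rule closed_Int_compact[OF assms(1)]) simp
  moreover have "continuous_on (C \<inter> sphere 0 1) (\<lambda>q. n \<bullet> q)" by (intro continuous_intros)
  ultimately obtain p where p: "p \<in> C \<inter> sphere 0 1" "\<And>q. q \<in> C \<inter> sphere 0 1 \<Longrightarrow> n \<bullet> p \<le> n \<bullet> q"
    using continuous_attains_inf[OF _ False, of "\<lambda>q. n \<bullet> q"] by blast
  have m: "n \<bullet> p > 0" using p(1) by (intro pos) auto
  have "norm P \<le> \<bar>t\<bar> / (n \<bullet> p)" if P: "P \<in> C" "n \<bullet> P \<le> t" for P
  proof (cases "P = 0")
    case False
    then have "(1 / norm P) *\<^sub>R P \<in> C \<inter> sphere 0 1"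
      using P assms(2) by (auto simp: conic_def)
    then have "n \<bullet> p \<le> n \<bullet> ((1 / norm P) *\<^sub>R P)" by (rule p(2))
    then have "(n \<bullet> p) * norm P \<le> n \<bullet> P" using False by (simp add: field_simps)
    also have "\<dots> \<le> \<bar>t\<bar>" using P by simp
    finally show ?thesis using m by (simp add: field_simps)
  qed (use m in simp)
  then show ?thesis unfolding bounded_iff by blast
qed

theorem theorem7p4:
  fixes C :: "(real ^ 'n) set"
  assumes "pointed_rational_cone C"
    and "aff_dim C = int CARD('n)"
  shows "diff_signature (ring_of_type_algebra :: 'k::field_char_0 ring)
           (semigroup_ring C) (homogeneous_max_ideal C) CARD('n)
         = fact CARD('n) *
           emeasure lborel {P \<in> C. (\<Sum>F | F facet_of C. facet_form C F P) \<le> 1}"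
proof -
  obtain b :: "(real ^ 'n) set \<Rightarrow> int ^ 'n" where b:
    "finite {F. F facet_of C}"
    "\<And>F. F facet_of C \<Longrightarrow> primitive_vec (b F)"
    "\<And>F. F facet_of C \<Longrightarrow> facet_form C F = (\<lambda>P. real_vec (b F) \<bullet> P)"
    "\<And>P. P \<in> C \<longleftrightarrow> (\<forall>F. F facet_of C \<longrightarrow> real_vec (b F) \<bullet> P \<ge> 0)"
    "\<And>F. F facet_of C \<Longrightarrow> \<exists>u. real_vec (b F) \<bullet> real_vec u = 0 \<and>
       (\<forall>F'. F' facet_of C \<longrightarrow> F' \<noteq> F \<longrightarrow> real_vec (b F') \<bullet> real_vec u > 0)"
    "\<exists>w. \<forall>F. F facet_of C \<longrightarrow> real_vec (b F) \<bullet> real_vec w > 0"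
    "\<And>P. (\<And>F. F facet_of C \<Longrightarrow> real_vec (b F) \<bullet> P = 0) \<Longrightarrow> P = 0"
    using cone_facet_data[OF assms] by blast
  define I where "I = {F. F facet_of C}"
  define a where "a F \<mu> = (\<Sum>i\<in>UNIV. b F $ i * \<mu> $ i)" for F and \<mu> :: "int ^ 'n"
  have a: "real_vec (b F) \<bullet> real_vec \<mu> = real_of_int (a F \<mu>)" for F \<mu>
    unfolding a_def by (rule inner_real_vec_real_vec)
  \<comment> \<open>The facets themselves index the forms, and \<open>a F\<close> is the form of
    \<open>F\<close> on lattice points, with values in the integers.\<close>
  interpret facet_cone C "TYPE('k)" I a
  proof unfold_locales
    show "finite I" using b(1) by (simp add: I_def)
    show "\<mu> \<in> lattice_points C \<longleftrightarrow> (\<forall>i\<in>I. a i \<mu> \<ge> 0)" for \<mu>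
      by (simp add: lattice_points_def b(4)[of "real_vec \<mu>"] a I_def)
    show "a F (x + y) = a F x + a F y" for F x y
      by (simp add: a_def distrib_left sum.distrib)
    show "\<exists>e. a F e = 1" if "F \<in> I" for F
      using primitive_vec_bezout[OF b(2)] that by (simp add: I_def a_def)
    show "\<exists>u. a F u = 0 \<and> (\<forall>k\<in>I - {F}. a k u > 0)" if "F \<in> I" for F
      using b(5)[of F] that by (auto simp: I_def a)
    show "\<exists>w. \<forall>F\<in>I. a F w > 0" using b(6) by (simp add: I_def a)
    show "\<mu> = 0" if "\<forall>F\<in>I. a F \<mu> = 0" for \<mu>
    proof -
      have "real_vec \<mu> = 0" by (rule b(7)) (use that in \<open>simp add: I_def a\<close>)
      then show ?thesis by (simp add: real_vec_def vec_eq_iff)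
    qed
  qed
  define n where "n = (\<Sum>F\<in>I. real_vec (b F))"
  have n: "(\<Sum>F | F facet_of C. facet_form C F P) = n \<bullet> P" for P
    unfolding n_def inner_sum_left I_def by (rule sum.cong) (auto simp: b(3))
  have n_ht: "n \<bullet> real_vec \<mu> = real_of_int (ht \<mu>)" for \<mu>
    by (simp add: n_def inner_sum_left a ht_def)
  obtain V :: "(int ^ 'n) set" where "finite V" "C = convex_cone hull (real_vec ` V)"
    using assms(1) by (auto simp: pointed_rational_cone_def)
  then have cc: "convex_cone C" and closed: "closed C"
    by (simp_all add: convex_cone_convex_cone_hull closed_convex_cone_hull)
  have pos: "n \<bullet> P > 0" if P: "P \<in> C" "P \<noteq> 0" for P
  proof -
    have nonneg: "real_vec (b F) \<bullet> P \<ge> 0" if "F \<in> I" for F using b(4) P that by (simp add: I_def)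
    obtain F where "F \<in> I" "real_vec (b F) \<bullet> P \<noteq> 0" using b(7)[of P] P(2) by (auto simp: I_def)
    then show ?thesis unfolding n_def inner_sum_left
      using nonneg by (intro sum_pos2[OF finite_I, of F]) (auto simp: less_le)
  qed
  \<comment> \<open>The strict inequality matches the count of exponents with
    \<open>ht \<mu> < int k\<close>; the boundary slice is added at the end.\<close>
  define T where "T = {P \<in> C. n \<bullet> P < 1}"
  have T_eq: "T = C \<inter> {P. n \<bullet> P < 1}" by (auto simp: T_def)
  have "bounded {P \<in> C. n \<bullet> P \<le> 1}"
    by (rule bounded_cone_slice[OF closed _ pos]) (use cc in \<open>simp_all add: convex_cone_def\<close>)
  then have bdd: "bounded T" by (rule bounded_subset) (auto simp: T_def)
  have conv: "convex T" unfolding T_eq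
    using cc by (intro convex_Int convex_halfspace_lt) (simp add: convex_cone_def)
  have borel: "T \<in> sets borel" unfolding T_eq
    by (intro sets.Int borel_closed closed borel_open open_halfspace_lt)
  have mem_T: "(1 / real k) *\<^sub>R real_vec z \<in> T \<longleftrightarrow> z \<in> S \<and> ht z < int k" if "k > 0" for k z
  proof -
    have "n \<bullet> real_vec z < real k \<longleftrightarrow> ht z < int k" by (metis n_ht of_int_less_iff of_int_of_nat_eq)
    moreover have "(1 / real k) *\<^sub>R real_vec z \<in> C \<longleftrightarrow> real_vec z \<in> C"
      using that by (simp add: b(4)[of "_ *\<^sub>R _"] b(4)[of "real_vec z"] zero_le_divide_iff)
    ultimately show ?thesis using that by (simp add: T_def lattice_points_def field_simps)
  qed
  let ?N = "\<lambda>k. card {\<mu> \<in> S. ht \<mu> < int k}"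
  have count: "{z. (1 / real k) *\<^sub>R real_vec z \<in> T} = {\<mu> \<in> S. ht \<mu> < int k}" if "k > 0" for k
    using mem_T[OF that] by auto
  have fin: "finite {\<mu> \<in> S. ht \<mu> < int k}" if "k > 0" for k
    using lattice_count_tendsto_measure(2)[OF bdd conv borel that] by (simp add: count[OF that])
  let ?d = "CARD('n)"
  let ?s = "\<lambda>k. ennreal_of_enat (module_length R (quotient_module R
      (diff_power (ring_of_type_algebra :: 'k ring) R (homogeneous_max_ideal C) k)))
      / ennreal (real k ^ ?d / fact ?d)"
  have s: "?s k = ennreal (fact ?d * (real (?N k) / real k ^ ?d))" if k: "k > 0" for k
  proof -
    have "?s k = ennreal (real (?N k)) / ennreal (real k ^ ?d / fact ?d)"
      using k by (simp add: module_length_diff_power fin ennreal_of_nat_eq_real_of_nat)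
    also have "\<dots> = ennreal (fact ?d * (real (?N k) / real k ^ ?d))"
      using k by (subst divide_ennreal) (auto simp: field_simps)
    finally show ?thesis .
  qed
  have "(\<lambda>k. real (card {z. (1 / real k) *\<^sub>R real_vec z \<in> T}) / real k ^ ?d) \<longlonglongrightarrow> measure lborel T"
    by (rule lattice_count_tendsto_measure(1)[OF bdd conv borel])
  then have "(\<lambda>k. real (?N k) / real k ^ ?d) \<longlonglongrightarrow> measure lborel T"
    by (rule Lim_transform_eventually)
       (use count in \<open>auto intro: eventually_mono[OF eventually_gt_at_top[of 0]]\<close>)
  then have "(\<lambda>k. ennreal (fact ?d * (real (?N k) / real k ^ ?d))) \<longlonglongrightarrow> ennreal (fact ?d * measure lborel T)"
    by (intro tendsto_ennrealI tendsto_mult_left)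
  then have "?s \<longlonglongrightarrow> ennreal (fact ?d * measure lborel T)"
    by (rule Lim_transform_eventually)
       (use s in \<open>auto intro: eventually_mono[OF eventually_gt_at_top[of 0]]\<close>)
  \<comment> \<open>The sequence converges, so its limit superior is its limit.\<close>
  then have "diff_signature (ring_of_type_algebra :: 'k ring) R (homogeneous_max_ideal C) ?d
      = ennreal (fact ?d * measure lborel T)"
    unfolding diff_signature_def by (intro lim_imp_Limsup) auto
  also have "\<dots> = fact ?d * emeasure lborel T"
    using emeasure_bounded_finite[OF bdd]
    by (simp add: ennreal_mult emeasure_eq_ennreal_measure flip: ennreal_fact)
  also have "emeasure lborel T = emeasure lborel {P \<in> C. n \<bullet> P \<le> 1}"
  proof -
    have null: "C \<inter> {P. n \<bullet> P = 1} \<in> null_sets lborel"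
    proof (rule null_sets_subset)
      \<comment> \<open>The level \<open>1\<close> is nonzero, so this set is null for every vector
        \<open>n\<close>.\<close>
      show "{P. n \<bullet> P = 1} \<in> null_sets lborel"
        using negligible_hyperplane[of n 1] null_sets_completion_iff[of "{P. n \<bullet> P = 1}" lborel]
        by (simp add: negligible_iff_null_sets borel_closed closed_hyperplane)
      show "C \<inter> {P. n \<bullet> P = 1} \<in> sets lborel"
        using closed closed_hyperplane by (auto intro: borel_closed)
    qed auto
    have "{P \<in> C. n \<bullet> P \<le> 1} = T \<union> (C \<inter> {P. n \<bullet> P = 1})" by (auto simp: T_def)
    then show ?thesis using emeasure_Un_null_set[OF _ null, of T] borel by simp
  qed
  finally show ?thesis unfolding n .
qed

end
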